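(* Let $C=\{\mathbf{x}\in\mathbb{R}^3:x_1^2+x_3^2<1\}$ be the open unit cylinder and fix $s\in(0,1]$. For $f\in L^2_c(C)$, $p>0$, $\phi_0\in[0,2\pi]$, $y_0\in\mathbb{R}$, let $R_sf(p,\phi_0,y_0)$ denote the integral of $f$ with respect to surface measure over the spheroid \[\{\mathbf{x}\in\mathbb{R}^3:(x_1-\cos\phi_0)^2+(x_3-\sin\phi_0)^2+s^2(x_2-y_0)^2=p^2\}.\] Then $R_s$ is injective on $L^2_c(C)$: if $f\in L^2_c(C)$ and $R_sf(p,\phi_0,y_0)=0$ for all $p>0$, $\phi_0\in[0,2\pi]$, $y_0\in\mathbb{R}$, then $f=0$.
   Context: $L^2_c(C)$ denotes square-integrable functions with compact support contained in $C$. The spheroids have centers $(\cos\phi_0,y_0,\sin\phi_0)$ on the boundary of the unit cylinder, axis of revolution parallel to the $x_2$-axis, and fixed aspect ratio determined by $s$. *)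

theory Defs
  imports "HOL-Analysis.Analysis" "HOL-Analysis.Cross3"
begin

definition unit_cyl :: "(real^3) set" where
  "unit_cyl = {x. (x$1)^2 + (x$3)^2 < 1}"

definition L2c :: "(real^3) set \<Rightarrow> (real^3 \<Rightarrow> complex) set" where
  "L2c S = {f. f \<in> borel_measurable lborel
              \<and> integrable lborel (\<lambda>x. (cmod (f x))^2)
              \<and> (\<exists>K. compact K \<and> K \<subseteq> S \<and> (\<forall>x. x \<notin> K \<longrightarrow> f x = 0))}"

text \<open>Parametrization of the spheroid
  (x1 - cos phi0)^2 + (x3 - sin phi0)^2 + s^2 (x2 - y0)^2 = p^2
  by spherical-type coordinates (t,u) in [0,pi] x [0,2 pi].\<close>
definition spheroid_param :: "real \<Rightarrow> real \<Rightarrow> real \<Rightarrow> real \<Rightarrow> real \<Rightarrow> real \<Rightarrow> real^3" where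
  "spheroid_param s p phi0 y0 t u =
     vector [cos phi0 + p * sin t * cos u, y0 + (p / s) * cos t, sin phi0 + p * sin t * sin u]"

definition spheroid_dt :: "real \<Rightarrow> real \<Rightarrow> real \<Rightarrow> real \<Rightarrow> real^3" where
  "spheroid_dt s p t u = vector [p * cos t * cos u, - (p / s) * sin t, p * cos t * sin u]"

definition spheroid_du :: "real \<Rightarrow> real \<Rightarrow> real \<Rightarrow> real \<Rightarrow> real^3" where
  "spheroid_du s p t u = vector [- p * sin t * sin u, 0, p * sin t * cos u]"

text \<open>Integral of f with respect to surface measure on the spheroid:
  surface element = norm of the cross product of the partial derivatives.\<close>
definition R_s :: "real \<Rightarrow> (real^3 \<Rightarrow> complex) \<Rightarrow> real \<Rightarrow> real \<Rightarrow> real \<Rightarrow> complex" where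
  "R_s s f p phi0 y0 =
     set_lebesgue_integral lborel ({0..pi} \<times> {0..2*pi})
       (\<lambda>(t,u). norm (cross3 (spheroid_dt s p t u) (spheroid_du s p t u))
                 *\<^sub>R f (spheroid_param s p phi0 y0 t u))"

end

theory Submission
  imports Defs "HOL-Probability.Sinc_Integral"
begin

text \<open>Write \<open>\<zeta> = x\<^sub>1 + i x\<^sub>3\<close>, \<open>y = x\<^sub>2\<close>, and let \<open>c\<close> be a point of the unit circle, \<open>d = \<bar>\<zeta> - c\<bar>\<close>,
  \<open>G\<^sup>2 = d\<^sup>2 + s\<^sup>2 (y - y\<^sub>0)\<^sup>2\<close>, \<open>W\<^sup>2 = d\<^sup>2 + s\<^sup>4 (y - y\<^sub>0)\<^sup>2\<close>. Integrating \<open>R\<^sub>s f\<close> over \<open>p\<close> against powers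
  of \<open>p\<close> shows that \<open>f\<close> is orthogonal to every \<open>W / G\<^sup>m\<close>. These kernels are homogeneous, so integrating
  further against \<open>y\<^sub>0\<^sup>j\<close> (with \<open>y\<^sub>0 = y + d v\<close>) gives, for all \<open>n\<close>, a relation between the integrals of
  \<open>f y\<^sup>i / d\<^sup>i\<^sup>+\<^sup>1\<^sup>+\<^sup>n\<close> for \<open>i \<le> j\<close> with a nonzero coefficient at \<open>i = j\<close>. As \<open>d\<close> is bounded away from \<open>0\<close> on
  the support, induction on \<open>j\<close> and the Weierstrass theorem in the variable \<open>1 / d\<close> show that \<open>f\<close> is orthogonal
  to \<open>y\<^sup>j \<phi>(d)\<close> for all continuous \<open>\<phi>\<close>, in particular to \<open>y\<^sup>j d\<^sup>2\<^sup>k\<close>. Comparing Fourier coefficients in \<open>c\<close> yields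
  orthogonality to all polynomials, and hence \<open>f = 0\<close>.\<close>

section \<open>Compactly supported functions orthogonal to polynomials\<close>

text \<open>The error of replacing \<open>g\<close> by \<open>h\<close> is at most \<open>e\<close>
  times the L1 norm of \<open>f\<close>. Only approximation on \<open>K\<close> matters, since
  \<open>f\<close> vanishes elsewhere. Used with polynomials in \<open>x\<close> and with
  polynomials in a reciprocal distance.\<close>

lemma integral_mult_eq_0_approx:
  fixes f g :: "'a \<Rightarrow> complex"
  assumes f: "integrable M f" and off: "\<And>x. x \<notin> K \<Longrightarrow> f x = 0"
    and g: "integrable M (\<lambda>x. f x * g x)"
    and approx: "\<And>e. 0 < e \<Longrightarrow> \<exists>h. integrable M (\<lambda>x. f x * h x) \<and>
      (\<integral>x. f x * h x \<partial>M) = 0 \<and> (\<forall>x\<in>K. cmod (g x - h x) \<le> e)"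
  shows "(\<integral>x. f x * g x \<partial>M) = 0"
proof -
  define A where "A = (\<integral>x. cmod (f x) \<partial>M)"
  have A: "0 \<le> A" by (simp add: A_def)
  have "cmod (\<integral>x. f x * g x \<partial>M) \<le> 0 + e" if "0 < e" for e
  proof -
    \<comment> \<open>The denominator is \<open>A + 1\<close> because \<open>A\<close> may be
      0.\<close>
    have "0 < e / (A + 1)" using that A by simp
    then obtain h where h: "integrable M (\<lambda>x. f x * h x)" "(\<integral>x. f x * h x \<partial>M) = 0"
        "\<And>x. x \<in> K \<Longrightarrow> cmod (g x - h x) \<le> e / (A + 1)"
      using approx by meson
    have "(\<integral>x. f x * g x \<partial>M) = (\<integral>x. f x * g x - f x * h x \<partial>M)"
      using g h by simp
    also have "cmod \<dots> \<le> (\<integral>x. cmod (f x * g x - f x * h x) \<partial>M)"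
      by (rule integral_norm_bound)
    also have "\<dots> \<le> (\<integral>x. cmod (f x) * (e / (A + 1)) \<partial>M)"
    proof (rule integral_mono)
      show "cmod (f x * g x - f x * h x) \<le> cmod (f x) * (e / (A + 1))" for x
      proof (cases "x \<in> K")
        case True
        then show ?thesis
          using mult_left_mono[OF h(3)[OF True], of "cmod (f x)"]
          by (simp add: norm_mult flip: right_diff_distrib)
      qed (simp add: off)
    qed (use f g h in auto)
    also have "\<dots> = A * (e / (A + 1))" using f by (simp add: A_def)
    also have "\<dots> \<le> e" using A that by (simp add: field_simps)
    finally show ?thesis by simp
  qed
  then have "cmod (\<integral>x. f x * g x \<partial>M) \<le> 0" by (rule field_le_epsilon)
  then show ?thesis by simp
qed

locale compactly_supported =
  fixes f :: "'a::euclidean_space \<Rightarrow> complex" and K :: "'a set"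
  assumes integrable_f: "integrable lborel f"
    and compact_K: "compact K"
    and off_K: "\<And>x. x \<notin> K \<Longrightarrow> f x = 0"
begin

lemma obtain_bound:
  assumes "continuous_on K g"
  obtains B where "0 \<le> B" "\<And>x. x \<in> K \<Longrightarrow> norm (g x) \<le> B"
proof -
  have "bounded (g ` K)"
    by (intro compact_imp_bounded compact_continuous_image assms compact_K)
  then obtain B where "0 < B" "\<forall>y\<in>g ` K. norm y \<le> B" unfolding bounded_pos by blast
  then show ?thesis using that[of B] by simp
qed

lemma integrable_mult_continuous:
  assumes "continuous_on K g"
  shows "integrable lborel (\<lambda>x. f x * g x)"
proof -
  obtain B where B: "0 \<le> B" "\<And>x. x \<in> K \<Longrightarrow> norm (g x) \<le> B"
    using obtain_bound[OF assms] by blast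
  \<comment> \<open>Nothing is known about \<open>g\<close> off \<open>K\<close>, not even
    measurability; the cut-off function is measurable and leaves the product unchanged.\<close>
  have eq: "f x * g x = f x * (indicator K x *\<^sub>R g x)" for x
    using off_K by (auto simp: indicator_def)
  have K: "K \<in> sets borel" using compact_K by (simp add: borel_compact)
  have [measurable]: "f \<in> borel_measurable borel"
    using borel_measurable_integrable[OF integrable_f] by simp
  have [measurable]: "(\<lambda>x. indicator K x *\<^sub>R g x) \<in> borel_measurable borel"
    by (rule borel_measurable_continuous_on_indicator[OF K assms])
  have "integrable lborel (\<lambda>x. f x * (indicator K x *\<^sub>R g x))"
  proof (rule Bochner_Integration.integrable_bound)
    show "integrable lborel (\<lambda>x. norm (f x) * B)" using integrable_f by simp
    show "AE x in lborel. norm (f x * (indicator K x *\<^sub>R g x)) \<le> norm (norm (f x) * B)"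
    proof (rule AE_I2)
      fix x
      show "norm (f x * (indicator K x *\<^sub>R g x)) \<le> norm (norm (f x) * B)"
      proof (cases "x \<in> K")
        case True
        have "norm (f x) * norm (g x) \<le> norm (f x) * B"
          by (intro mult_left_mono B True norm_ge_zero)
        with True B(1) show ?thesis by (simp add: norm_mult abs_mult)
      qed simp
    qed
    show "(\<lambda>x. f x * (indicator K x *\<^sub>R g x)) \<in> borel_measurable lborel"
      by (intro borel_measurable_times) simp_all
  qed
  then show ?thesis by (simp only: eq[symmetric])
qed

lemma integral_continuous_eq_0:
  fixes g :: "'a \<Rightarrow> real"
  assumes poly: "\<And>P. real_polynomial_function P \<Longrightarrow> (\<integral>x. f x * of_real (P x) \<partial>lborel) = 0"
    and g: "continuous_on K g"
  shows "(\<integral>x. f x * of_real (g x) \<partial>lborel) = 0"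
proof (rule integral_mult_eq_0_approx[OF integrable_f off_K])
  show "integrable lborel (\<lambda>x. f x * of_real (g x))"
    by (intro integrable_mult_continuous continuous_intros g)
  fix e :: real assume "0 < e"
  then obtain P where P: "real_polynomial_function P" "\<And>x. x \<in> K \<Longrightarrow> \<bar>g x - P x\<bar> < e"
    using Stone_Weierstrass_real_polynomial_function[OF compact_K g] by metis
  show "\<exists>h. integrable lborel (\<lambda>x. f x * h x) \<and> (\<integral>x. f x * h x \<partial>lborel) = 0 \<and>
      (\<forall>x\<in>K. cmod (of_real (g x) - h x) \<le> e)"
  proof (intro exI conjI ballI)
    show "integrable lborel (\<lambda>x. f x * of_real (P x))"
      by (intro integrable_mult_continuous continuous_intros
          continuous_on_polymonial_function) (use P real_polynomial_function_eq in blast)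
    show "cmod (of_real (g x) - of_real (P x)) \<le> e" if "x \<in> K" for x
      using P(2)[OF that] by (simp flip: of_real_diff)
  qed (rule poly[OF P(1)])
qed

text \<open>Orthogonality passes from polynomials to continuous functions by Stone-Weierstrass, to
  indicators of closed sets by dominated convergence, and to all Borel sets because the closed sets
  are an intersection-stable generator.\<close>

lemma AE_eq_0_if_polynomials:
  assumes poly: "\<And>P. real_polynomial_function P \<Longrightarrow> (\<integral>x. f x * of_real (P x) \<partial>lborel) = 0"
  shows "AE x in lborel. f x = 0"
proof (rule sigma_finite_measure.density_zero[OF lborel.sigma_finite_measure_axioms integrable_f])
  have sint: "integrable lborel (\<lambda>x. indicator A x *\<^sub>R f x)" if "A \<in> sets borel" for A
    using integrable_f that by (intro integrable_mult_indicator) auto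
  have closed: "(\<integral>x. indicator C x *\<^sub>R f x \<partial>lborel) = 0" if C: "closed C" for C
  proof (cases "C = {}")
    case False
    \<comment> \<open>These continuous functions decrease to the indicator of \<open>C\<close>. The
      empty set is treated apart because \<open>infdist\<close> to it is 0 by convention.\<close>
    define g where "g n x = max 0 (1 - real n * infdist x C)" for n x
    have "(\<lambda>n. \<integral>x. f x * of_real (g n x) \<partial>lborel) \<longlonglongrightarrow> (\<integral>x. indicator C x *\<^sub>R f x \<partial>lborel)"
    proof (rule integral_dominated_convergence)
      show "(\<lambda>x. indicator C x *\<^sub>R f x) \<in> borel_measurable lborel"
        by (rule borel_measurable_integrable[OF sint]) (use C in simp)
      show "integrable lborel (\<lambda>x. norm (f x))" using integrable_f by simp
      show "(\<lambda>x. f x * of_real (g n x)) \<in> borel_measurable lborel" for n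
        unfolding g_def
        by (intro borel_measurable_integrable integrable_mult_continuous continuous_intros)
      show "AE x in lborel. norm (f x * of_real (g n x)) \<le> norm (f x)" for n
      proof (rule AE_I2)
        fix x
        have "0 \<le> g n x" "g n x \<le> 1" by (auto simp: g_def infdist_nonneg)
        then show "norm (f x * of_real (g n x)) \<le> norm (f x)"
          by (simp add: norm_mult mult_left_le)
      qed
      show "AE x in lborel. (\<lambda>n. f x * of_real (g n x)) \<longlonglongrightarrow> indicator C x *\<^sub>R f x"
      proof (rule AE_I2)
        fix x
        show "(\<lambda>n. f x * of_real (g n x)) \<longlonglongrightarrow> indicator C x *\<^sub>R f x"
        proof (cases "x \<in> C")
          case True
          then show ?thesis by (simp add: g_def)
        next
          case False
          then have pos: "0 < infdist x C"
            by (rule infdist_pos_not_in_closed[OF C \<open>C \<noteq> {}\<close>])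
          obtain N :: nat where N: "1 < real N * infdist x C"
            using reals_Archimedean3[OF pos] by blast
          have "f x * of_real (g n x) = 0" if "N \<le> n" for n
          proof -
            have "real N * infdist x C \<le> real n * infdist x C"
              using that pos by (intro mult_right_mono) auto
            then show ?thesis using N by (simp add: g_def)
          qed
          then have "eventually (\<lambda>n. f x * of_real (g n x) = 0) sequentially"
            by (rule eventually_sequentiallyI)
          then show ?thesis using False by (simp add: tendsto_eventually)
        qed
      qed
    qed
    moreover have "(\<integral>x. f x * of_real (g n x) \<partial>lborel) = 0" for n
      unfolding g_def by (intro integral_continuous_eq_0[OF poly] continuous_intros)
    ultimately show ?thesis by (simp add: LIMSEQ_const_iff)
  qed simp
  fix A :: "'a set" assume A: "A \<in> sets lborel"
  then have "Int_stable (Collect (closed :: 'a set \<Rightarrow> bool))" "Collect closed \<subseteq> Pow (UNIV :: 'a set)"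
      "A \<in> sigma_sets UNIV (Collect closed)"
    by (auto simp: Int_stable_def borel_eq_closed)
  then have "(\<integral>x. indicator A x *\<^sub>R f x \<partial>lborel) = 0"
  proof (induct A rule: sigma_sets_induct_disjoint)
    case (basic A)
    then show ?case using closed by simp
  next
    case (compl A)
    then have A: "A \<in> sets borel" by (simp add: borel_eq_closed)
    have "(\<integral>x. indicator (UNIV - A) x *\<^sub>R f x \<partial>lborel)
        = (\<integral>x. indicator UNIV x *\<^sub>R f x - indicator A x *\<^sub>R f x \<partial>lborel)"
      by (intro Bochner_Integration.integral_cong) (auto simp: indicator_def)
    also have "\<dots> = 0"
      by (subst Bochner_Integration.integral_diff) (use sint A closed[of UNIV] compl integrable_f in auto)
    finally show ?case .
  next
    case (union A)
    then have A: "A i \<in> sets lborel" for i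
      by (auto simp: borel_eq_closed)
    then have "set_integrable lborel (\<Union>i. A i) f"
      unfolding set_integrable_def by (intro integrable_mult_indicator integrable_f) auto
    from lebesgue_integral_countable_add[OF A _ this] have
      "(\<integral>x\<in>(\<Union>i. A i). f x \<partial>lborel) = (\<Sum>i. \<integral>x\<in>A i. f x \<partial>lborel)"
      using union(1) by (auto simp: disjoint_family_on_def)
    then show ?case using union(3) by (simp add: set_lebesgue_integral_def)
  qed simp
  then show "set_lebesgue_integral lborel A f = 0" by (simp add: set_lebesgue_integral_def)
qed

end

section \<open>Powers of the distance to points of the unit circle\<close>

text \<open>Makes a polynomial that vanishes at every \<open>cis t\<close> the zero
  polynomial.\<close>

lemma infinite_range_cis: "infinite (range cis)"
proof
  assume "finite (range cis)"
  then have "finite (cis ` {0..pi})" by (rule finite_subset[rotated]) auto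
  moreover have "inj_on cis {0..pi}"
  proof (rule inj_onI)
    fix x y assume "x \<in> {0..pi}" "y \<in> {0..pi}" "cis x = cis y"
    then show "x = y" using cos_inj_pi[of x y] by (auto simp: complex_eq_iff)
  qed
  ultimately have "finite {0..pi}" by (rule finite_imageD)
  then show False using infinite_Icc[of 0 pi] pi_gt_zero by simp
qed

text \<open>The hypothesis is what remains when the vanishing integrals of \<open>f\<close> against
  the powers \<open>2 * k\<close> of the distance to \<open>cis t\<close> are multiplied by
  \<open>cis t ^ k\<close> and expanded, \<open>I p q\<close> being the moment of
  \<open>z ^ p * cnj z ^ q\<close>. Strong induction on \<open>k\<close> settles all
  \<open>p\<close> and \<open>q\<close> up to \<open>k\<close>.\<close>

lemma complex_moments_eq_0:
  fixes I :: "nat \<Rightarrow> nat \<Rightarrow> complex"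
  assumes I: "\<And>k t. (\<Sum>p\<le>k. \<Sum>q\<le>k.
     (-1) ^ (p + q) * of_nat (k choose p) * of_nat (k choose q) * I p q * cis t ^ (k - p + q)) = 0"
  shows "I p q = 0"
proof -
  define b where "b k p q = (-1) ^ (p + q) * of_nat (k choose p) * of_nat (k choose q) * I p q" for k p q
  have "\<forall>p\<le>k. \<forall>q\<le>k. I p q = 0" for k
  proof (induction k rule: less_induct)
    case (less k)
    \<comment> \<open>The power of \<open>cis t\<close> determines \<open>q - p\<close>, and two distinct pairs with equal difference have
      distinct maxima; modulo the induction hypothesis each coefficient is a single moment.\<close>
    define P where "P = (\<Sum>(p, q)\<in>{..k} \<times> {..k}. monom (b k p q) (k - p + q))"
    have "poly P (cis t) = 0" for t
      using I[of k t] by (simp only: P_def b_def sum.cartesian_product[symmetric] poly_sum poly_monom)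
    then have "range cis \<subseteq> {z. poly P z = 0}" by auto
    then have P0: "P = 0"
      using infinite_range_cis poly_roots_finite[of P] finite_subset by blast
    have main: "I p q = 0" if pq: "p \<le> k" "q \<le> k" "p = k \<or> q = k" for p q
    proof -
      have "0 = coeff P (k - p + q)" using P0 by simp
      also have "\<dots> = (\<Sum>(p', q')\<in>{..k} \<times> {..k}. if k - p' + q' = k - p + q then b k p' q' else 0)"
        by (simp add: P_def coeff_sum case_prod_unfold)
      also have "\<dots> = (\<Sum>(p', q')\<in>{(p, q)}. if k - p' + q' = k - p + q then b k p' q' else 0)"
      proof (rule sum.mono_neutral_right)
        show "\<forall>u\<in>{..k} \<times> {..k} - {(p, q)}.
            (case u of (p', q') \<Rightarrow> if k - p' + q' = k - p + q then b k p' q' else 0) = 0"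
        proof
          fix u assume u: "u \<in> {..k} \<times> {..k} - {(p, q)}"
          obtain p' q' where u': "u = (p', q')" by (cases u)
          have "b k p' q' = 0" if "k - p' + q' = k - p + q"
          proof -
            have "max p' q' < k" using pq u u' that by auto
            then have "I p' q' = 0" using less.IH[of "max p' q'"] by simp
            then show "b k p' q' = 0" by (simp add: b_def)
          qed
          then show "(case u of (p', q') \<Rightarrow> if k - p' + q' = k - p + q then b k p' q' else 0) = 0"
            by (simp add: u')
        qed
      qed (use pq in auto)
      finally have "b k p q = 0" by simp
      then show ?thesis using pq by (simp add: b_def)
    qed
    show ?case
    proof (intro allI impI)
      fix p q assume "p \<le> k" "q \<le> k"
      then show "I p q = 0"
        using main[of p q] less.IH[of "max p q"] by (cases "max p q < k") (auto simp: max_def split: if_splits)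
    qed
  qed
  then show ?thesis by (meson max.cobounded1 max.cobounded2)
qed

section \<open>Moments in \<open>zeta\<close>, its conjugate and the height\<close>

definition zeta :: "real^3 \<Rightarrow> complex" where
  "zeta x = Complex (x $ 1) (x $ 3)"

lemma continuous_on_zeta [continuous_intros]: "continuous_on A zeta"
  unfolding zeta_def Complex_eq by (intro continuous_intros)

text \<open>On the unit circle \<open>c * \<bar>z - c\<bar>\<^sup>2 = (c - z) * (1 - c * cnj z)\<close>, so that even powers of the distance
  are trigonometric polynomials in \<open>c\<close>.\<close>

lemma cis_mult_cmod_diff_power:
  "cis t ^ k * of_real (cmod (z - cis t) ^ (2 * k)) =
    (\<Sum>p\<le>k. \<Sum>q\<le>k. (-1) ^ (p + q) * of_nat (k choose p) * of_nat (k choose q)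
       * (z ^ p * cnj z ^ q) * cis t ^ (k - p + q))"
proof -
  let ?c = "cis t"
  have "?c * of_real (cmod (z - ?c) ^ 2) = ?c * ((z - ?c) * (cnj z - cnj ?c))"
    by (simp only: complex_norm_square complex_cnj_diff)
  also have "\<dots> = (z - ?c) * (?c * cnj z - ?c * cnj ?c)" by (simp add: algebra_simps)
  also have "\<dots> = (- z + ?c) * (- (?c * cnj z) + 1)"
    by (simp add: cis_cnj cis_mult algebra_simps)
  finally have eq: "?c * of_real (cmod (z - ?c) ^ 2) = (- z + ?c) * (- (?c * cnj z) + 1)" .
  have "?c ^ k * of_real (cmod (z - ?c) ^ (2 * k)) = (?c * of_real (cmod (z - ?c) ^ 2)) ^ k"
    by (simp only: power_mult power_mult_distrib of_real_power)
  also have "\<dots> = (- z + ?c) ^ k * (- (?c * cnj z) + 1) ^ k"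
    by (simp only: eq power_mult_distrib)
  also have "\<dots> = (\<Sum>p\<le>k. of_nat (k choose p) * (- z) ^ p * ?c ^ (k - p)) *
      (\<Sum>q\<le>k. of_nat (k choose q) * (- (?c * cnj z)) ^ q)"
    by (simp only: binomial_ring[of "- z"] binomial_ring[of "- (?c * cnj z)"] power_one mult_1_right)
  also have "\<dots> = (\<Sum>p\<le>k. \<Sum>q\<le>k. (-1) ^ (p + q) * of_nat (k choose p) * of_nat (k choose q)
       * (z ^ p * cnj z ^ q) * ?c ^ (k - p + q))"
    unfolding sum_product
    by (intro sum.cong refl)
      (simp add: power_add power_mult_distrib power_minus[of z] power_minus[of "?c * cnj z"]
        del: Nat.add_diff_assoc2)
  finally show ?thesis .
qed

text \<open>The complex span of the monomials whose integrals are moments. Having only monomials and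
  sums as generators lets orthogonality be carried over by linearity.\<close>

inductive coordinate_polynomial :: "(real^3 \<Rightarrow> complex) \<Rightarrow> bool" where
  monomial: "coordinate_polynomial (\<lambda>x. a * (of_real (x $ 2) ^ j * (zeta x ^ p * cnj (zeta x) ^ q)))"
| add: "coordinate_polynomial g \<Longrightarrow> coordinate_polynomial h \<Longrightarrow> coordinate_polynomial (\<lambda>x. g x + h x)"

lemma coordinate_polynomial_mult:
  assumes "coordinate_polynomial g" "coordinate_polynomial h"
  shows "coordinate_polynomial (\<lambda>x. g x * h x)"
  using assms(1)
proof induction
  case (monomial a j p q)
  from assms(2) show ?case
  proof induction
    case (monomial b i r t)
    show ?case
      using coordinate_polynomial.monomial[of "a * b" "j + i" "p + r" "q + t"]
      by (simp add: power_add mult_ac)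
  qed (simp add: distrib_left coordinate_polynomial.add)
qed (simp add: distrib_right coordinate_polynomial.add)

lemma real_polynomial_imp_coordinate_polynomial:
  "real_polynomial_function P \<Longrightarrow> coordinate_polynomial (\<lambda>x. of_real (P x))"
proof (induction rule: real_polynomial_function.induct)
  case (linear P)
  interpret P: bounded_linear P by fact
  define a where "a i = complex_of_real (P (axis i 1))" for i
  \<comment> \<open>Inserts \<open>x $ 1 = (zeta x + cnj (zeta x)) / 2\<close> and
    \<open>x $ 3 = (zeta x - cnj (zeta x)) / (2 * \<i>)\<close> into the coordinate expansion of
    \<open>P\<close>.\<close>
  have eq: "complex_of_real (P x) =
      (a 1 - \<i> * a 3) / 2 * (of_real (x $ 2) ^ 0 * (zeta x ^ 1 * cnj (zeta x) ^ 0)) +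
      ((a 1 + \<i> * a 3) / 2 * (of_real (x $ 2) ^ 0 * (zeta x ^ 0 * cnj (zeta x) ^ 1)) +
      a 2 * (of_real (x $ 2) ^ 1 * (zeta x ^ 0 * cnj (zeta x) ^ 0)))" for x
  proof -
    have "P x = P (\<Sum>i\<in>UNIV. x $ i *s axis i 1)" by (simp only: basis_expansion)
    also have "\<dots> = x $ 1 * P (axis 1 1) + x $ 2 * P (axis 2 1) + x $ 3 * P (axis 3 1)"
      by (simp add: sum_3 P.add P.scaleR scalar_mult_eq_scaleR)
    finally show ?thesis by (simp add: a_def zeta_def complex_eq_iff field_simps)
  qed
  show ?case unfolding eq by (intro coordinate_polynomial.intros)
next
  case (const c)
  show ?case using coordinate_polynomial.monomial[of "of_real c" 0 0 0] by simp
qed (simp_all add: coordinate_polynomial.add coordinate_polynomial_mult)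

locale cylinder_supported = compactly_supported f K
  for f :: "real^3 \<Rightarrow> complex" and K +
  assumes K_subset: "K \<subseteq> unit_cyl"
begin

text \<open>For fixed \<open>j\<close>, the factor \<open>cis t ^ k\<close> turns each hypothesis
  into a vanishing polynomial in \<open>cis t\<close> with multiples of moments as coefficients.
  Then \<open>complex_moments_eq_0\<close> gives that all moments vanish, and linearity extends this
  to all polynomials.\<close>

lemma AE_eq_0_if_distance_powers:
  assumes "\<And>j k t. (\<integral>x. f x * (of_real (x $ 2) ^ j * of_real (cmod (zeta x - cis t) ^ (2 * k))) \<partial>lborel) = 0"
  shows "AE x in lborel. f x = 0"
proof (rule AE_eq_0_if_polynomials)
  define I where "I j p q = (\<integral>x. f x * (of_real (x $ 2) ^ j * (zeta x ^ p * cnj (zeta x) ^ q)) \<partial>lborel)" for j p q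
  have int: "integrable lborel (\<lambda>x. f x * (of_real (x $ 2) ^ j * (zeta x ^ p * cnj (zeta x) ^ q)))" for j p q
    by (intro integrable_mult_continuous continuous_intros)
  have I0: "I j p q = 0" for j p q
  proof (rule complex_moments_eq_0)
    fix k t
    let ?a = "\<lambda>p q. (-1) ^ (p + q) * of_nat (k choose p) * of_nat (k choose q) * cis t ^ (k - p + q)"
    have "(\<Sum>p\<le>k. \<Sum>q\<le>k. (-1) ^ (p + q) * of_nat (k choose p) * of_nat (k choose q) * I j p q * cis t ^ (k - p + q))
        = (\<Sum>p\<le>k. \<Sum>q\<le>k. \<integral>x. ?a p q * (f x * (of_real (x $ 2) ^ j * (zeta x ^ p * cnj (zeta x) ^ q))) \<partial>lborel)"
      unfolding I_def integral_mult_right_zero by (simp only: mult_ac)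
    also have "\<dots> = (\<integral>x. (\<Sum>p\<le>k. \<Sum>q\<le>k. ?a p q * (f x * (of_real (x $ 2) ^ j * (zeta x ^ p * cnj (zeta x) ^ q)))) \<partial>lborel)"
      using int by (simp add: Bochner_Integration.integral_sum)
    also have "\<dots> = (\<integral>x. cis t ^ k * (f x * (of_real (x $ 2) ^ j * of_real (cmod (zeta x - cis t) ^ (2 * k)))) \<partial>lborel)"
    proof (rule Bochner_Integration.integral_cong[OF refl])
      fix x
      have "(\<Sum>p\<le>k. \<Sum>q\<le>k. ?a p q * (f x * (of_real (x $ 2) ^ j * (zeta x ^ p * cnj (zeta x) ^ q))))
         = f x * of_real (x $ 2) ^ j * (cis t ^ k * of_real (cmod (zeta x - cis t) ^ (2 * k)))"
        unfolding cis_mult_cmod_diff_power sum_distrib_left by (intro sum.cong refl) (simp only: mult_ac)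
      then show "(\<Sum>p\<le>k. \<Sum>q\<le>k. ?a p q * (f x * (of_real (x $ 2) ^ j * (zeta x ^ p * cnj (zeta x) ^ q))))
         = cis t ^ k * (f x * (of_real (x $ 2) ^ j * of_real (cmod (zeta x - cis t) ^ (2 * k))))"
        by (simp only: mult_ac)
    qed
    also have "\<dots> = 0" using assms by simp
    finally show "(\<Sum>p\<le>k. \<Sum>q\<le>k. (-1) ^ (p + q) * of_nat (k choose p) * of_nat (k choose q) * I j p q * cis t ^ (k - p + q)) = 0" .
  qed
  fix P :: "real^3 \<Rightarrow> real" assume "real_polynomial_function P"
  then have "coordinate_polynomial (\<lambda>x. of_real (P x))"
    by (rule real_polynomial_imp_coordinate_polynomial)
  then have "integrable lborel (\<lambda>x. f x * of_real (P x)) \<and> (\<integral>x. f x * of_real (P x) \<partial>lborel) = 0"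
  proof induction
    case (monomial a j p q)
    have eq: "f x * (a * (of_real (x $ 2) ^ j * (zeta x ^ p * cnj (zeta x) ^ q)))
      = a * (f x * (of_real (x $ 2) ^ j * (zeta x ^ p * cnj (zeta x) ^ q)))" for x by (simp only: mult_ac)
    show ?case unfolding eq using int[of j p q] I0[of j p q] by (simp add: I_def)
  qed (simp add: distrib_left)
  then show "(\<integral>x. f x * of_real (P x) \<partial>lborel) = 0" by simp
qed

end

section \<open>Moments of the homogeneous kernels\<close>

text \<open>The spheroid is \<open>stretched_norm s d z = p\<close>, where \<open>d\<close> is the distance to its axis
  and \<open>z\<close> the height above its centre; \<open>stretched_norm (s\<^sup>2) d z / stretched_norm s d z\<close> is the length
  of the gradient of this function, i.e. the density of surface measure relative to the slicing of
  Lebesgue measure by \<open>p\<close>.\<close>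

definition stretched_norm :: "real \<Rightarrow> real \<Rightarrow> real \<Rightarrow> real" where
  "stretched_norm s d z = sqrt (d\<^sup>2 + (s * z)\<^sup>2)"

lemma stretched_norm_ge: "0 \<le> d \<Longrightarrow> d \<le> stretched_norm s d z" "\<bar>s * z\<bar> \<le> stretched_norm s d z"
  by (auto simp: stretched_norm_def intro!: real_le_rsqrt)

text \<open>This homogeneity lets the substitution \<open>z = d * v\<close> split a kernel into a
  power of \<open>d\<close> and a function of \<open>v\<close> alone.\<close>

lemma stretched_norm_scale: "0 \<le> d \<Longrightarrow> stretched_norm s d (d * v) = d * stretched_norm s 1 v"
proof -
  have "d\<^sup>2 + (s * (d * v))\<^sup>2 = d\<^sup>2 * (1\<^sup>2 + (s * v)\<^sup>2)"
    by (simp add: power_mult_distrib algebra_simps)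
  then show "0 \<le> d \<Longrightarrow> ?thesis" by (simp add: stretched_norm_def real_sqrt_mult)
qed

lemma stretched_norm_minus [simp]: "stretched_norm s d (- z) = stretched_norm s d z"
  by (simp add: stretched_norm_def)

lemma stretched_norm_nonneg [simp]: "0 \<le> stretched_norm s d z"
  by (simp add: stretched_norm_def)

lemma stretched_norm_pos: "0 < d \<Longrightarrow> 0 < stretched_norm s d z"
  using stretched_norm_ge(1)[of d s z] by simp

text \<open>Here \<open>s \<le> 1\<close> enters, through \<open>s ^ 4 \<le> s ^ 2\<close>: the
  numerator of each kernel is bounded by the base of its denominator.\<close>

lemma stretched_norm_square_le: "0 < s \<Longrightarrow> s \<le> 1 \<Longrightarrow> stretched_norm (s\<^sup>2) d z \<le> stretched_norm s d z"
  unfolding stretched_norm_def power_mult_distrib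
  by (intro real_sqrt_le_mono add_left_mono mult_right_mono power_mono)
     (auto simp: power2_eq_square mult_left_le)

lemma continuous_on_stretched_norm [continuous_intros]:
  "continuous_on A d \<Longrightarrow> continuous_on A z \<Longrightarrow> continuous_on A (\<lambda>x. stretched_norm s (d x) (z x))"
  unfolding stretched_norm_def by (intro continuous_intros)

lemma borel_measurable_stretched_norm [measurable (raw)]:
  assumes [measurable]: "d \<in> borel_measurable M" "z \<in> borel_measurable M"
  shows "(\<lambda>x. stretched_norm s (d x) (z x)) \<in> borel_measurable M"
  unfolding stretched_norm_def by measurable

lemma borel_measurable_zeta [measurable]: "zeta \<in> borel_measurable borel"
  by (intro borel_measurable_continuous_onI continuous_on_zeta)

text \<open>With \<open>G\<close> the norm in the denominator, the numerator is at most
  \<open>C ^ l * G ^ (l + 1)\<close>, which leaves \<open>1 / G ^ (2 + n)\<close>. The factor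
  \<open>1 / G ^ n\<close> is controlled by \<open>\<epsilon> \<le> G\<close>, and
  \<open>1 / G ^ 2\<close> by \<open>1 / (1 + u ^ 2)\<close>, since both 1 and \<open>u ^ 2\<close>
  are at most multiples of \<open>G ^ 2\<close>. The majorant does not depend on \<open>d\<close>
  and \<open>z\<close>, as Fubini requires later.\<close>

lemma kernel_bound:
  assumes s: "0 < s" "s \<le> 1" and \<epsilon>: "0 < \<epsilon>" "\<epsilon> \<le> d" and u: "\<bar>u\<bar> \<le> C * stretched_norm s d z"
  shows "\<bar>u ^ l * stretched_norm (s\<^sup>2) d z / stretched_norm s d z ^ (l + 3 + n)\<bar> \<le> C ^ l * (1 / \<epsilon>\<^sup>2 + C\<^sup>2) / \<epsilon> ^ n * (1 / (1 + u\<^sup>2))"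
proof -
  define G where "G = stretched_norm s d z"
  have G: "\<epsilon> \<le> G" "0 < G"
    using stretched_norm_ge(1)[of d s z] \<epsilon> by (auto simp: G_def)
  have C: "0 \<le> C * G" using u abs_ge_zero[of u] unfolding G_def by linarith
  then have C0: "0 \<le> C" using G by (simp add: zero_le_mult_iff)
  have W: "stretched_norm (s\<^sup>2) d z \<le> G" unfolding G_def by (rule stretched_norm_square_le[OF s])
  have "1 \<le> (G / \<epsilon>)\<^sup>2" using G \<epsilon> by (simp add: one_le_power)
  moreover have "u\<^sup>2 \<le> (C * G)\<^sup>2" using u C unfolding G_def by (subst abs_le_square_iff[symmetric]) simp
  ultimately have q: "1 + u\<^sup>2 \<le> (1 / \<epsilon>\<^sup>2 + C\<^sup>2) * G\<^sup>2"
    by (simp add: power_mult_distrib power_divide algebra_simps)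
  have pos: "0 < 1 + u\<^sup>2" by (simp add: add_pos_nonneg)
  have q': "1 / G\<^sup>2 \<le> (1 / \<epsilon>\<^sup>2 + C\<^sup>2) * (1 / (1 + u\<^sup>2))"
    using q pos G by (simp add: divide_simps mult_ac)
  have "\<bar>u ^ l * stretched_norm (s\<^sup>2) d z / G ^ (l + 3 + n)\<bar> = \<bar>u\<bar> ^ l * stretched_norm (s\<^sup>2) d z / G ^ (l + 3 + n)"
    using G by (simp add: abs_mult power_abs)
  also have "\<dots> \<le> (C * G) ^ l * G / G ^ (l + 3 + n)"
    using u W G C unfolding G_def[symmetric]
    by (intro divide_right_mono mult_mono power_mono) auto
  also have "\<dots> = C ^ l * (1 / G\<^sup>2) * (1 / G ^ n)"
    using G by (simp add: field_simps power_add power3_eq_cube power2_eq_square)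
  also have "\<dots> \<le> C ^ l * ((1 / \<epsilon>\<^sup>2 + C\<^sup>2) * (1 / (1 + u\<^sup>2))) * (1 / \<epsilon> ^ n)"
    using q' G \<epsilon> C0 pos
    by (intro mult_mono mult_left_mono divide_left_mono power_mono) (auto intro!: mult_nonneg_nonneg add_nonneg_nonneg)
  finally show ?thesis by (simp add: G_def mult_ac)
qed

lemma integrable_inverse_one_plus_square: "integrable lborel (\<lambda>x::real. 1 / (1 + x\<^sup>2))"
proof -
  have I: "set_integrable lborel {0<..} (\<lambda>x::real. 1 / (1 + x\<^sup>2))"
    using integrable_I0i_1_div_plus_square
    by (simp add: interval_lebesgue_integrable_def einterval_def zero_ereal_def greaterThan_def)
  \<comment> \<open>The negative half-line follows by reflection; the point 0 left out is a null
    set.\<close>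
  from lborel_integrable_real_affine[OF I[unfolded set_integrable_def], of "-1" 0]
  have J: "set_integrable lborel {..<0} (\<lambda>x::real. 1 / (1 + x\<^sup>2))"
    unfolding set_integrable_def by (simp add: indicator_def)
  have "set_integrable lborel ({0<..} \<union> {..<0}) (\<lambda>x::real. 1 / (1 + x\<^sup>2))"
    by (rule set_integrable_Un[OF I J]) auto
  then have "integrable lborel (\<lambda>x::real. indicator ({0<..} \<union> {..<0}) x *\<^sub>R (1 / (1 + x\<^sup>2)))"
    unfolding set_integrable_def .
  then show ?thesis
  proof (rule integrable_cong_AE_imp)
    show "AE x::real in lborel. indicator ({0<..} \<union> {..<0}) x *\<^sub>R (1 / (1 + x\<^sup>2)) = 1 / (1 + x\<^sup>2)"
      using AE_lborel_singleton[of "0::real"] by eventually_elim (auto simp: indicator_def)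
  qed simp
qed

text \<open>By homogeneity, integrals of a kernel at any distance \<open>d\<close> against powers of
  the height reduce to these numbers.\<close>

definition profile_moment :: "real \<Rightarrow> nat \<Rightarrow> nat \<Rightarrow> real" where
  "profile_moment s l m = (\<integral>v. v ^ l * stretched_norm (s\<^sup>2) 1 v / stretched_norm s 1 v ^ m \<partial>lborel)"

lemma integrable_profile:
  assumes s: "0 < s" "s \<le> 1" and m: "l + 3 \<le> m"
  shows "integrable lborel (\<lambda>v. v ^ l * stretched_norm (s\<^sup>2) 1 v / stretched_norm s 1 v ^ m)"
proof -
  obtain n where m: "m = l + 3 + n" using m le_Suc_ex by blast
  show ?thesis
  proof (rule Bochner_Integration.integrable_bound)
    show "integrable lborel (\<lambda>v::real. (1 / s) ^ l * (1 / 1\<^sup>2 + (1 / s)\<^sup>2) / 1 ^ n * (1 / (1 + v\<^sup>2)))"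
      by (intro integrable_mult_right integrable_inverse_one_plus_square)
    show "AE v in lborel. norm (v ^ l * stretched_norm (s\<^sup>2) 1 v / stretched_norm s 1 v ^ m)
        \<le> norm ((1 / s) ^ l * (1 / 1\<^sup>2 + (1 / s)\<^sup>2) / 1 ^ n * (1 / (1 + v\<^sup>2)))"
    proof (rule AE_I2)
      fix v
      have "\<bar>v\<bar> \<le> 1 / s * stretched_norm s 1 v"
        using stretched_norm_ge(2)[of s v 1] s by (simp add: field_simps abs_mult)
      from kernel_bound[OF s _ _ this, of 1 l n]
      have "\<bar>v ^ l * stretched_norm (s\<^sup>2) 1 v / stretched_norm s 1 v ^ m\<bar> \<le> (1 / s) ^ l * (1 / 1\<^sup>2 + (1 / s)\<^sup>2) / 1 ^ n * (1 / (1 + v\<^sup>2))"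
        by (simp add: m)
      then show "norm (v ^ l * stretched_norm (s\<^sup>2) 1 v / stretched_norm s 1 v ^ m)
        \<le> norm ((1 / s) ^ l * (1 / 1\<^sup>2 + (1 / s)\<^sup>2) / 1 ^ n * (1 / (1 + v\<^sup>2)))"
        unfolding real_norm_def by (rule order_trans[OF _ abs_ge_self])
    qed
  qed measurable
qed

text \<open>The integrand is positive. The bound \<open>3 \<le> m\<close> ensures integrability; the
  Bochner integral of a non-integrable function would be 0 by default. These are the diagonal
  coefficients in the induction on \<open>j\<close>.\<close>

lemma profile_moment_0_nonzero:
  assumes s: "0 < s" "s \<le> 1" and m: "3 \<le> m"
  shows "profile_moment s 0 m \<noteq> 0"
proof
  assume 0: "profile_moment s 0 m = 0"
  have int: "integrable lborel (\<lambda>v. stretched_norm (s\<^sup>2) 1 v / stretched_norm s 1 v ^ m)"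
    using integrable_profile[OF s, of 0 m] m by simp
  have pos: "0 < stretched_norm (s\<^sup>2) 1 v / stretched_norm s 1 v ^ m" for v by (simp add: stretched_norm_pos)
  have "AE v in lborel. stretched_norm (s\<^sup>2) 1 v / stretched_norm s 1 v ^ m = 0"
    using 0 integral_nonneg_eq_0_iff_AE[OF int] pos by (simp add: profile_moment_def less_imp_le)
  then have "AE v::real in lborel. v \<notin> UNIV"
    by (rule eventually_mono) (metis pos less_irrefl)
  then have "(UNIV :: real set) \<in> null_sets lborel"
    by (subst AE_iff_null_sets) auto
  then show False by (simp add: null_sets_def)
qed

text \<open>Substitute \<open>y + d * v\<close> for \<open>v\<close>, use that the kernel is even
  and homogeneous, and expand \<open>(y + d * v) ^ j\<close> by the binomial theorem.\<close>

lemma integral_moment_kernel: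
  assumes s: "0 < s" "s \<le> 1" and d: "0 < d"
  shows "(\<integral>v. v ^ j * stretched_norm (s\<^sup>2) d (y - v) / stretched_norm s d (y - v) ^ (j + 3 + n) \<partial>lborel)
     = (\<Sum>i\<le>j. of_nat (j choose i) * profile_moment s (j - i) (j + 3 + n) * (y ^ i * (1 / d ^ (i + 1 + n))))"
proof -
  let ?m = "j + 3 + n"
  let ?h = "\<lambda>l v. v ^ l * stretched_norm (s\<^sup>2) 1 v / stretched_norm s 1 v ^ ?m"
  have "(\<integral>v. v ^ j * stretched_norm (s\<^sup>2) d (y - v) / stretched_norm s d (y - v) ^ ?m \<partial>lborel)
     = d * (\<integral>v. (y + d * v) ^ j * stretched_norm (s\<^sup>2) d (y - (y + d * v)) / stretched_norm s d (y - (y + d * v)) ^ ?m \<partial>lborel)"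
    using lborel_integral_real_affine[of d "\<lambda>v. v ^ j * stretched_norm (s\<^sup>2) d (y - v) / stretched_norm s d (y - v) ^ ?m" y] d
    by simp
  also have "\<dots> = (\<integral>v. (\<Sum>i\<le>j. (of_nat (j choose i) * (y ^ i * (1 / d ^ (i + 1 + n)))) * ?h (j - i) v) \<partial>lborel)"
  proof (subst integral_mult_right_zero[symmetric], rule Bochner_Integration.integral_cong[OF refl])
    fix v
    have "d * ((y + d * v) ^ j * stretched_norm (s\<^sup>2) d (y - (y + d * v)) / stretched_norm s d (y - (y + d * v)) ^ ?m)
       = d * ((\<Sum>i\<le>j. of_nat (j choose i) * y ^ i * (d * v) ^ (j - i)) *
          (d * stretched_norm (s\<^sup>2) 1 v) / (d * stretched_norm s 1 v) ^ ?m)"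
      using d by (simp add: binomial_ring[of y "d * v"] stretched_norm_scale)
    also have "\<dots> = (\<Sum>i\<le>j. d * (of_nat (j choose i) * y ^ i * (d * v) ^ (j - i) *
          (d * stretched_norm (s\<^sup>2) 1 v) / (d * stretched_norm s 1 v) ^ ?m))"
      by (simp only: sum_distrib_left sum_distrib_right sum_divide_distrib)
    also have "\<dots> = (\<Sum>i\<le>j. (of_nat (j choose i) * (y ^ i * (1 / d ^ (i + 1 + n)))) * ?h (j - i) v)"
    proof (intro sum.cong refl)
      fix i assume "i \<in> {..j}"
      \<comment> \<open>Powers of \<open>d\<close>: one from the substitution, \<open>j - i\<close>
        from the monomial and one from the numerator of the kernel, against \<open>?m\<close> in the
        denominator.\<close>
      then have "d * d ^ (j - i) * d * d ^ (i + 1 + n) = d ^ ?m"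
        by (simp add: numeral_3_eq_3 flip: power_Suc power_add power_Suc2)
      then have e: "d * d ^ (j - i) * d / d ^ ?m = 1 / d ^ (i + 1 + n)"
        using d by (simp add: field_simps)
      have "d * (of_nat (j choose i) * y ^ i * (d * v) ^ (j - i) *
          (d * stretched_norm (s\<^sup>2) 1 v) / (d * stretched_norm s 1 v) ^ ?m)
        = (d * d ^ (j - i) * d / d ^ ?m) * (of_nat (j choose i) * y ^ i * ?h (j - i) v)"
        by (simp add: power_mult_distrib)
      then show "d * (of_nat (j choose i) * y ^ i * (d * v) ^ (j - i) *
          (d * stretched_norm (s\<^sup>2) 1 v) / (d * stretched_norm s 1 v) ^ ?m)
        = (of_nat (j choose i) * (y ^ i * (1 / d ^ (i + 1 + n)))) * ?h (j - i) v"
        unfolding e by (simp only: mult_ac)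
    qed
    finally show "d * ((y + d * v) ^ j * stretched_norm (s\<^sup>2) d (y - (y + d * v)) / stretched_norm s d (y - (y + d * v)) ^ ?m)
       = (\<Sum>i\<le>j. (of_nat (j choose i) * (y ^ i * (1 / d ^ (i + 1 + n)))) * ?h (j - i) v)" .
  qed
  also have "\<dots> = (\<Sum>i\<le>j. \<integral>v. (of_nat (j choose i) * (y ^ i * (1 / d ^ (i + 1 + n)))) * ?h (j - i) v \<partial>lborel)"
    by (intro Bochner_Integration.integral_sum integrable_mult_right integrable_profile s) auto
  also have "\<dots> = (\<Sum>i\<le>j. (of_nat (j choose i) * (y ^ i * (1 / d ^ (i + 1 + n)))) * profile_moment s (j - i) ?m)"
    by (simp only: integral_mult_right_zero profile_moment_def)
  finally show ?thesis by (simp only: mult_ac)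
qed

lemma (in pair_sigma_finite) integrable_mult_pair:
  fixes u v :: "_ \<Rightarrow> real"
  assumes u: "integrable M1 u" and v: "integrable M2 v"
  shows "integrable (M1 \<Otimes>\<^sub>M M2) (\<lambda>(x, y). u x * v y)"
proof (rule Fubini_integrable)
  have [measurable]: "u \<in> borel_measurable M1" "v \<in> borel_measurable M2"
    using u v by simp_all
  show "(\<lambda>(x, y). u x * v y) \<in> borel_measurable (M1 \<Otimes>\<^sub>M M2)" by measurable
  show "integrable M1 (\<lambda>x. \<integral>y. norm (case (x, y) of (x, y) \<Rightarrow> u x * v y) \<partial>M2)"
    using u v by (simp add: abs_mult)
  show "AE x in M1. integrable M2 (\<lambda>y. case (x, y) of (x, y) \<Rightarrow> u x * v y)"
    using v by simp
qed

section \<open>From the kernels to functions of the distance\<close>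

context cylinder_supported
begin

text \<open>By compactness \<open>cmod (zeta x)\<close> attains a maximum below 1 on
  \<open>K\<close>; the triangle inequality then gives both bounds uniformly in
  \<open>t\<close>.\<close>

lemma obtain_distance_bound:
  obtains \<epsilon> where "0 < \<epsilon>" "\<And>x t. x \<in> K \<Longrightarrow> \<epsilon> \<le> cmod (zeta x - cis t) \<and> cmod (zeta x - cis t) \<le> 2"
proof (cases "K = {}")
  case True
  then show ?thesis using that[of 1] by simp
next
  case False
  have "continuous_on K (\<lambda>x. cmod (zeta x))" by (intro continuous_intros)
  from continuous_attains_sup[OF compact_K False this]
  obtain w where w: "w \<in> K" "\<And>x. x \<in> K \<Longrightarrow> cmod (zeta x) \<le> cmod (zeta w)" by blast
  have "cmod (zeta w) < 1"
    using w(1) K_subset by (auto simp: unit_cyl_def zeta_def cmod_def)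
  moreover have "1 - cmod (zeta w) \<le> cmod (zeta x - cis t) \<and> cmod (zeta x - cis t) \<le> 2" if "x \<in> K" for x t
    using w(2)[OF that] norm_triangle_ineq2[of "cis t" "zeta x"] norm_triangle_ineq4[of "zeta x" "cis t"]
      \<open>cmod (zeta w) < 1\<close>
    by (auto simp: norm_minus_commute)
  ultimately show ?thesis using that[of "1 - cmod (zeta w)"] by simp
qed

text \<open>Multiply the hypothesis for \<open>m = j + 3 + n\<close> by \<open>y0 ^ j\<close>,
  integrate over \<open>y0\<close> and exchange the integrals; the inner integral is evaluated by
  \<open>integral_moment_kernel\<close>.\<close>

lemma moment_kernel_identity:
  assumes s: "0 < s" "s \<le> 1"
    and kernel: "\<And>y0 m. (\<integral>x. f x * of_real (stretched_norm (s\<^sup>2) (cmod (zeta x - cis t)) (x $ 2 - y0)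
       / stretched_norm s (cmod (zeta x - cis t)) (x $ 2 - y0) ^ m) \<partial>lborel) = 0"
  shows "(\<integral>x. f x * of_real (\<Sum>i\<le>j. of_nat (j choose i) * profile_moment s (j - i) (j + 3 + n)
     * ((x $ 2) ^ i * (1 / cmod (zeta x - cis t) ^ (i + 1 + n)))) \<partial>lborel) = 0"
proof -
  define d where "d x = cmod (zeta x - cis t)" for x
  obtain \<epsilon> where \<epsilon>: "0 < \<epsilon>" "\<And>x. x \<in> K \<Longrightarrow> \<epsilon> \<le> d x"
    using obtain_distance_bound d_def by metis
  have cont: "continuous_on K (\<lambda>x. x $ 2)" by (intro continuous_intros)
  obtain B where B: "0 \<le> B" "\<And>x. x \<in> K \<Longrightarrow> \<bar>x $ 2\<bar> \<le> B"
    using obtain_bound[OF cont, unfolded real_norm_def] by blast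
  let ?m = "j + 3 + n"
  let ?k = "\<lambda>x v. v ^ j * stretched_norm (s\<^sup>2) (d x) (x $ 2 - v) / stretched_norm s (d x) (x $ 2 - v) ^ ?m"
  \<comment> \<open>Read off from \<open>\<bar>v\<bar> \<le> \<bar>x $ 2\<bar> + \<bar>x $ 2 -
    v\<bar>\<close>: with \<open>G\<close> the norm in the denominator, the first term is at most
    \<open>B / \<epsilon> * G\<close> and the second at most \<open>1 / s * G\<close>.\<close>
  define C where "C = B / \<epsilon> + 1 / s"
  define D where "D = C ^ j * (1 / \<epsilon>\<^sup>2 + C\<^sup>2) / \<epsilon> ^ n"
  have bound: "\<bar>?k x v\<bar> \<le> D * (1 / (1 + v\<^sup>2))" if x: "x \<in> K" for x v
    unfolding D_def
  proof (rule kernel_bound[OF s \<epsilon>])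
    let ?G = "stretched_norm s (d x) (x $ 2 - v)"
    have "\<bar>x $ 2\<bar> \<le> B / \<epsilon> * \<epsilon>" using B(2)[OF x] \<epsilon>(1) by simp
    also have "\<dots> \<le> B / \<epsilon> * ?G"
      using B(1) stretched_norm_ge(1)[of "d x" s "x $ 2 - v"] \<epsilon>(1) \<epsilon>(2)[OF x]
      by (intro mult_left_mono) auto
    finally have "\<bar>x $ 2\<bar> \<le> B / \<epsilon> * ?G" .
    moreover have "\<bar>x $ 2 - v\<bar> \<le> 1 / s * ?G"
      using stretched_norm_ge(2)[of s "x $ 2 - v" "d x"] s unfolding abs_mult by (simp add: field_simps)
    ultimately show "\<bar>v\<bar> \<le> C * ?G" by (simp add: C_def distrib_right)
  qed (rule x)
  have [measurable]: "f \<in> borel_measurable borel"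
    using borel_measurable_integrable[OF integrable_f] by simp
  have [measurable]: "d \<in> borel_measurable borel"
    unfolding d_def by measurable
  have int: "integrable (lborel \<Otimes>\<^sub>M lborel) (\<lambda>(x, v). f x * of_real (?k x v))"
  proof (rule Bochner_Integration.integrable_bound)
    show "integrable (lborel \<Otimes>\<^sub>M lborel) (\<lambda>(x, v). norm (f x) * (D * (1 / (1 + v\<^sup>2))))"
      by (intro lborel_pair.integrable_mult_pair integrable_norm integrable_f integrable_mult_right
          integrable_inverse_one_plus_square)
    show "AE p in lborel \<Otimes>\<^sub>M lborel. norm (case p of (x, v) \<Rightarrow> f x * of_real (?k x v))
       \<le> norm (case p of (x, v) \<Rightarrow> norm (f x) * (D * (1 / (1 + v\<^sup>2))))"
    proof (rule AE_I2)
      fix p :: "(real^3) \<times> real"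
      obtain x v where p: "p = (x, v)" by (cases p)
      show "norm (case p of (x, v) \<Rightarrow> f x * of_real (?k x v))
         \<le> norm (case p of (x, v) \<Rightarrow> norm (f x) * (D * (1 / (1 + v\<^sup>2))))"
      proof (cases "x \<in> K")
        case True
        have "norm (f x) * \<bar>?k x v\<bar> \<le> norm (f x) * (D * (1 / (1 + v\<^sup>2)))"
          by (rule mult_left_mono[OF bound[OF True]]) simp
        also have "\<dots> \<le> norm (norm (f x) * (D * (1 / (1 + v\<^sup>2))))"
          unfolding real_norm_def by (rule abs_ge_self)
        finally show ?thesis unfolding p by (simp only: prod.case norm_mult norm_of_real)
      qed (simp add: p off_K)
    qed
    have [measurable]: "(\<lambda>x::real^3. x $ 2) \<in> borel_measurable borel"
      by (intro borel_measurable_continuous_onI continuous_intros)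
    have "(\<lambda>(x, v). f x * of_real (?k x v)) \<in> borel_measurable (borel \<Otimes>\<^sub>M borel)"
      by measurable
    then show "(\<lambda>(x, v). f x * of_real (?k x v)) \<in> borel_measurable (lborel \<Otimes>\<^sub>M lborel)"
      by (simp cong: measurable_cong_sets sets_pair_measure_cong)
  qed
  have eq: "f x * of_real (\<Sum>i\<le>j. of_nat (j choose i) * profile_moment s (j - i) ?m
     * ((x $ 2) ^ i * (1 / d x ^ (i + 1 + n)))) = (\<integral>v. f x * of_real (?k x v) \<partial>lborel)" for x
  proof (cases "x \<in> K")
    case True
    then have "0 < d x" using \<epsilon> by fastforce
    from integral_moment_kernel[OF s this, of j "x $ 2" n] show ?thesis
      by (simp only: integral_mult_right_zero integral_complex_of_real)
  qed (simp add: off_K)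
  have "(\<integral>x. f x * of_real (\<Sum>i\<le>j. of_nat (j choose i) * profile_moment s (j - i) ?m
     * ((x $ 2) ^ i * (1 / d x ^ (i + 1 + n)))) \<partial>lborel)
    = (\<integral>v. (\<integral>x. f x * of_real (?k x v) \<partial>lborel) \<partial>lborel)"
    unfolding eq by (rule lborel_pair.Fubini_integral[OF int, symmetric])
  also have "\<dots> = (\<integral>v. of_real (v ^ j) * (\<integral>x. f x * of_real (stretched_norm (s\<^sup>2) (d x) (x $ 2 - v)
       / stretched_norm s (d x) (x $ 2 - v) ^ ?m) \<partial>lborel) \<partial>lborel)"
    unfolding integral_mult_right_zero[symmetric]
    by (intro Bochner_Integration.integral_cong refl) (simp add: mult_ac)
  also have "\<dots> = 0" by (simp only: d_def kernel mult_zero_right Bochner_Integration.integral_zero)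
  finally show ?thesis by (simp only: d_def)
qed

text \<open>Induction on \<open>j\<close> for all \<open>\<phi>\<close> at once: in
  \<open>moment_kernel_identity\<close> the terms with \<open>i < j\<close> vanish by the induction
  hypothesis and the coefficient at \<open>i = j\<close> is nonzero. So \<open>f\<close> is
  orthogonal to \<open>y ^ j / d ^ (j + 1)\<close> times every power of \<open>1 / d\<close>, and
  Weierstrass approximation in \<open>1 / d\<close> gives the rest.\<close>

lemma integral_distance_function_eq_0:
  assumes s: "0 < s" "s \<le> 1"
    and kernel: "\<And>y0 m. (\<integral>x. f x * of_real (stretched_norm (s\<^sup>2) (cmod (zeta x - cis t)) (x $ 2 - y0)
       / stretched_norm s (cmod (zeta x - cis t)) (x $ 2 - y0) ^ m) \<partial>lborel) = 0"
    and \<phi>: "continuous_on {0<..} \<phi>"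
  shows "(\<integral>x. f x * of_real ((x $ 2) ^ j * \<phi> (cmod (zeta x - cis t))) \<partial>lborel) = 0"
  using \<phi>
proof (induction j arbitrary: \<phi> rule: less_induct)
  case (less j)
  define d where "d x = cmod (zeta x - cis t)" for x
  obtain \<epsilon> where \<epsilon>: "0 < \<epsilon>" "\<And>x. x \<in> K \<Longrightarrow> \<epsilon> \<le> d x" "\<And>x. x \<in> K \<Longrightarrow> d x \<le> 2"
    using obtain_distance_bound d_def by metis
  have d_pos: "0 < d x" if "x \<in> K" for x using \<epsilon>(1) \<epsilon>(2)[OF that] by simp
  have cont_d: "continuous_on K d" unfolding d_def by (intro continuous_intros)
  have cont: "continuous_on K (\<lambda>x. (x $ 2) ^ i * \<psi> (d x))" if "continuous_on {0<..} \<psi>" for i and \<psi> :: "real \<Rightarrow> real"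
    by (intro continuous_intros continuous_on_compose2[OF that cont_d]) (use d_pos in auto)
  have inv_cont: "continuous_on {0<..} (\<lambda>r::real. 1 / r ^ k)" for k
    by (intro continuous_intros) auto
  have powers: "(\<integral>x. f x * of_real ((x $ 2) ^ j * (1 / d x ^ (j + 1 + n))) \<partial>lborel) = 0" for n
  proof -
    let ?c = "\<lambda>i. of_nat (j choose i) * profile_moment s (j - i) (j + 3 + n)"
    let ?L = "\<lambda>i. (\<integral>x. f x * of_real ((x $ 2) ^ i * (1 / d x ^ (i + 1 + n))) \<partial>lborel)"
    have int: "integrable lborel (\<lambda>x. f x * of_real ((x $ 2) ^ i * (1 / d x ^ (i + 1 + n))))" for i
      by (intro integrable_mult_continuous continuous_on_of_real cont inv_cont)
    have "0 = (\<integral>x. f x * of_real (\<Sum>i\<le>j. ?c i * ((x $ 2) ^ i * (1 / d x ^ (i + 1 + n)))) \<partial>lborel)"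
      unfolding d_def by (rule moment_kernel_identity[OF s kernel, symmetric])
    also have "\<dots> = (\<integral>x. (\<Sum>i\<le>j. of_real (?c i) * (f x * of_real ((x $ 2) ^ i * (1 / d x ^ (i + 1 + n))))) \<partial>lborel)"
      unfolding of_real_sum sum_distrib_left of_real_mult[of "?c _"] by (simp only: mult_ac)
    also have "\<dots> = (\<Sum>i\<le>j. of_real (?c i) * ?L i)"
      using int by (simp only: Bochner_Integration.integral_sum integrable_mult_right integral_mult_right_zero)
    also have "\<dots> = (\<Sum>i\<in>{j}. of_real (?c i) * ?L i)"
    proof (rule sum.mono_neutral_right)
      show "\<forall>i\<in>{..j} - {j}. of_real (?c i) * ?L i = 0"
      proof
        fix i assume "i \<in> {..j} - {j}"
        then have "?L i = 0" unfolding d_def by (intro less.IH inv_cont) auto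
        then show "of_real (?c i) * ?L i = 0" by (simp only: mult_zero_right)
      qed
    qed auto
    finally have "of_real (profile_moment s 0 (j + 3 + n)) * ?L j = 0" by simp
    then show ?thesis using profile_moment_0_nonzero[OF s, of "j + 3 + n"] by simp
  qed
  have "(\<integral>x. f x * of_real ((x $ 2) ^ j * \<phi> (d x)) \<partial>lborel) = 0"
  proof (rule integral_mult_eq_0_approx[OF integrable_f off_K])
    show "integrable lborel (\<lambda>x. f x * of_real ((x $ 2) ^ j * \<phi> (d x)))"
      by (intro integrable_mult_continuous continuous_on_of_real cont less.prems)
    fix e :: real assume e: "0 < e"
    obtain B where B: "0 \<le> B" "\<And>x. x \<in> K \<Longrightarrow> \<bar>(x $ 2) ^ j * (1 / d x ^ (j + 1))\<bar> \<le> B"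
      using obtain_bound[OF cont[OF inv_cont], unfolded real_norm_def] by blast
    \<comment> \<open>At \<open>u = 1 / d\<close> this is \<open>\<phi> d * d ^ (j + 1)\<close>, so
      the target is \<open>\<psi> (1 / d)\<close> times the factor bounded by \<open>B\<close>. As
      \<open>\<epsilon> \<le> d \<le> 2\<close> on \<open>K\<close>, \<open>u\<close> stays in a
      compact interval.\<close>
    define \<psi> where "\<psi> u = \<phi> (1 / u) * (1 / u) ^ (j + 1)" for u
    have "continuous_on {1 / 2..1 / \<epsilon>} \<psi>" unfolding \<psi>_def
      by (intro continuous_intros continuous_on_compose2[OF less.prems]) auto
    moreover have "0 < e / (B + 1)" using e B(1) by simp
    ultimately obtain P where P: "real_polynomial_function P"
        "\<And>u. u \<in> {1 / 2..1 / \<epsilon>} \<Longrightarrow> \<bar>\<psi> u - P u\<bar> < e / (B + 1)"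
      using Stone_Weierstrass_real_polynomial_function[of "{1 / 2..1 / \<epsilon>}" \<psi>] compact_Icc by metis
    obtain a N where Pa: "P = (\<lambda>u. \<Sum>n\<le>N. a n * u ^ n)"
      using real_polynomial_function_imp_sum[OF P(1)] by blast
    define h where "h x = (x $ 2) ^ j * (1 / d x ^ (j + 1)) * P (1 / d x)" for x
    have h: "f x * of_real (h x) = (\<Sum>n\<le>N. of_real (a n) * (f x * of_real ((x $ 2) ^ j * (1 / d x ^ (j + 1 + n)))))" for x
    proof -
      have "h x = (\<Sum>n\<le>N. a n * ((x $ 2) ^ j * (1 / d x ^ (j + 1 + n))))"
        unfolding h_def Pa sum_distrib_left
        by (intro sum.cong refl) (simp add: power_add power_one_over field_simps)
      then show ?thesis by (simp only: of_real_sum sum_distrib_left of_real_mult[of "a _"] mult_ac)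
    qed
    have int: "integrable lborel (\<lambda>x. of_real (a n) * (f x * of_real ((x $ 2) ^ j * (1 / d x ^ (j + 1 + n)))))" for n
      by (intro integrable_mult_right integrable_mult_continuous continuous_on_of_real cont inv_cont)
    show "\<exists>h. integrable lborel (\<lambda>x. f x * h x) \<and> (\<integral>x. f x * h x \<partial>lborel) = 0 \<and>
        (\<forall>x\<in>K. cmod (of_real ((x $ 2) ^ j * \<phi> (d x)) - h x) \<le> e)"
    proof (intro exI[of _ "\<lambda>x. of_real (h x)"] conjI ballI)
      show "integrable lborel (\<lambda>x. f x * of_real (h x))"
        unfolding h by (intro Bochner_Integration.integrable_sum int)
      show "(\<integral>x. f x * of_real (h x) \<partial>lborel) = 0"
        unfolding h using int
        by (simp only: Bochner_Integration.integral_sum integral_mult_right_zero powers mult_zero_right sum.neutral_const)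
      fix x assume x: "x \<in> K"
      have u: "1 / d x \<in> {1 / 2..1 / \<epsilon>}"
        using \<epsilon>(1) \<epsilon>(2,3)[OF x] d_pos[OF x] by (auto intro!: divide_left_mono)
      have "(x $ 2) ^ j * \<phi> (d x) - h x = (x $ 2) ^ j * (1 / d x ^ (j + 1)) * (\<psi> (1 / d x) - P (1 / d x))"
        using d_pos[OF x] by (simp add: h_def \<psi>_def field_simps)
      then have "cmod (of_real ((x $ 2) ^ j * \<phi> (d x)) - of_real (h x))
          = \<bar>(x $ 2) ^ j * (1 / d x ^ (j + 1))\<bar> * \<bar>\<psi> (1 / d x) - P (1 / d x)\<bar>"
        by (simp only: norm_of_real abs_mult flip: of_real_diff)
      also have "\<dots> \<le> (B + 1) * (e / (B + 1))"
        using B(1) B(2)[OF x] P(2)[OF u] by (intro mult_mono) auto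
      finally show "cmod (of_real ((x $ 2) ^ j * \<phi> (d x)) - of_real (h x)) \<le> e"
        using B(1) by simp
    qed
  qed
  then show ?case by (simp only: d_def)
qed

end

section \<open>Spheroidal coordinates\<close>

text \<open>The image of \<open>S\<close> is the whole space up to a null set, so the right-hand
  integral needs no domain. Components reduce the claim to scalar integrands, and Borel
  measurability of \<open>g\<close> and \<open>J\<close> brings the result from Lebesgue measure
  back to \<open>lborel\<close>.\<close>

lemma integral_change_of_variables_lborel:
  fixes F :: "real^'n::{finite,wellorder} \<Rightarrow> 'b::euclidean_space" and g :: "real^'n::_ \<Rightarrow> real^'n::_"
  assumes F: "integrable lborel F"
    and S: "S \<in> sets borel" and inj: "inj_on g S" and null: "negligible (- g ` S)"
    and der: "\<And>v. v \<in> S \<Longrightarrow> (g has_derivative g' v) (at v within S)"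
    and J: "\<And>v. v \<in> S \<Longrightarrow> \<bar>det (matrix (g' v))\<bar> = J v"
    and [measurable]: "g \<in> borel_measurable borel" "J \<in> borel_measurable borel"
  shows "integrable lborel (\<lambda>v. indicator S v *\<^sub>R J v *\<^sub>R F (g v))" (is "integrable lborel ?H")
    and "(\<integral>v. indicator S v *\<^sub>R J v *\<^sub>R F (g v) \<partial>lborel) = (\<integral>x. F x \<partial>lborel)"
proof -
  have [measurable]: "S \<in> sets borel" "F \<in> borel_measurable borel"
    using S borel_measurable_integrable[OF F] by simp_all
  have H[measurable]: "?H \<in> borel_measurable borel" by measurable
  have component: "integrable lborel (\<lambda>v. ?H v \<bullet> b) \<and> (\<integral>v. ?H v \<bullet> b \<partial>lborel) = (\<integral>x. F x \<bullet> b \<partial>lborel)" for b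
  proof -
    let ?F = "\<lambda>x. F x \<bullet> b"
    have intF: "integrable lborel ?F" using F by simp
    then have "set_integrable lborel UNIV ?F" by (simp add: set_integrable_def)
    then have "?F absolutely_integrable_on UNIV"
      using intF by (simp add: set_integrable_def integrable_completion)
    then have 1: "?F absolutely_integrable_on (g ` S)"
      by (rule absolutely_integrable_spike_set_eq[THEN iffD1, rotated 2])
        (auto intro: negligible_subset[OF null])
    have "integral UNIV ?F = integral (g ` S) ?F"
      by (rule integral_spike_set) (auto intro: negligible_subset[OF null])
    then have 2: "integral (g ` S) ?F = (\<integral>x. ?F x \<partial>lborel)"
      using integral_lborel[OF intF] by simp
    \<comment> \<open>The scalar component is embedded into \<open>real^1\<close>, since the change
      of variables theorem takes vector-valued integrands.\<close>
    have "(\<lambda>v. \<bar>det (matrix (g' v))\<bar> *\<^sub>R vec (?F (g v)) :: real^1) absolutely_integrable_on S \<and>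
        integral S (\<lambda>v. \<bar>det (matrix (g' v))\<bar> *\<^sub>R vec (?F (g v)) :: real^1) = vec (\<integral>x. ?F x \<partial>lborel)"
      using 1 2 S by (subst has_absolute_integral_change_of_variables[OF _ der inj])
        (auto simp: absolutely_integrable_on_1_iff integral_on_1_eq)
    then have "(\<lambda>v. \<bar>det (matrix (g' v))\<bar> * ?F (g v)) absolutely_integrable_on S"
        "integral S (\<lambda>v. \<bar>det (matrix (g' v))\<bar> * ?F (g v)) = (\<integral>x. ?F x \<partial>lborel)"
      by (simp_all add: absolutely_integrable_on_1_iff integral_on_1_eq)
    moreover have "(\<lambda>v. indicator S v *\<^sub>R (\<bar>det (matrix (g' v))\<bar> * ?F (g v))) = (\<lambda>v. indicator S v *\<^sub>R (J v * ?F (g v)))"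
      by (auto simp: indicator_def J)
    moreover have "integral S (\<lambda>v. \<bar>det (matrix (g' v))\<bar> * ?F (g v)) = integral S (\<lambda>v. J v * ?F (g v))"
      by (rule Henstock_Kurzweil_Integration.integral_cong) (simp add: J)
    ultimately have 3: "(\<lambda>v. J v * ?F (g v)) absolutely_integrable_on S"
        "integral S (\<lambda>v. J v * ?F (g v)) = (\<integral>x. ?F x \<partial>lborel)"
      unfolding set_integrable_def by simp_all
    have eq: "?H v \<bullet> b = indicator S v *\<^sub>R (J v * ?F (g v))" for v by simp
    have meas: "(\<lambda>v. ?H v \<bullet> b) \<in> borel_measurable lborel" by measurable
    have "integrable lebesgue (\<lambda>v. ?H v \<bullet> b)"
      using 3(1) unfolding set_integrable_def eq .
    then have "integrable lborel (\<lambda>v. ?H v \<bullet> b)"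
      using integrable_completion[OF meas] by simp
    moreover have "(\<integral>v. ?H v \<bullet> b \<partial>lborel) = (\<integral>x. ?F x \<partial>lborel)"
      using set_lebesgue_integral_eq_integral(2)[OF 3(1)] integral_completion[OF meas] 3(2)
      unfolding set_lebesgue_integral_def eq by simp
    ultimately show ?thesis ..
  qed
  have "integrable lborel (\<lambda>v. \<Sum>b\<in>Basis. (?H v \<bullet> b) *\<^sub>R b)"
    using component by (intro Bochner_Integration.integrable_sum integrable_scaleR_left) blast
  then show int: "integrable lborel ?H" by (simp only: euclidean_representation)
  show "integral\<^sup>L lborel ?H = (\<integral>x. F x \<partial>lborel)"
  proof (rule euclidean_eqI)
    fix b :: 'b
    have "integral\<^sup>L lborel ?H \<bullet> b = (\<integral>v. ?H v \<bullet> b \<partial>lborel)"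
      using int by (rule integral_inner_left[symmetric])
    also have "\<dots> = (\<integral>x. F x \<bullet> b \<partial>lborel)" using component by blast
    also have "\<dots> = (\<integral>x. F x \<partial>lborel) \<bullet> b" using F by (rule integral_inner_left)
    finally show "integral\<^sup>L lborel ?H \<bullet> b = (\<integral>x. F x \<partial>lborel) \<bullet> b" .
  qed
qed

lemma continuous_on_vector_3:
  fixes a b c :: "'a::topological_space \<Rightarrow> real"
  assumes "continuous_on A a" "continuous_on A b" "continuous_on A c"
  shows "continuous_on A (\<lambda>x. vector [a x, b x, c x] :: real^3)"
proof -
  have "continuous_on A (\<lambda>x. (vector [a x, b x, c x] :: real^3) $ i)" for i
    using exhaust_3[of i] assms by auto
  then have "continuous_on A (\<lambda>x. \<chi> i. (vector [a x, b x, c x] :: real^3) $ i)"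
    by (rule continuous_on_vec_lambda)
  then show ?thesis by simp
qed

lemma continuous_on_triple_vector: "continuous_on UNIV (\<lambda>(p, t, u). vector [p, t, u] :: real^3)"
  unfolding case_prod_unfold by (intro continuous_on_vector_3 continuous_intros)

text \<open>Lebesgue measure is determined by its values on boxes, and the preimage of a box is a
  product of three intervals. This makes Fubini available on \<open>real^3\<close>, with the first
  coordinate split off.\<close>

lemma lborel_vector_3:
  "(lborel :: (real^3) measure) = distr lborel borel (\<lambda>(p, t, u). vector [p, t, u])"
proof (rule lborel_eqI)
  have [measurable]: "(\<lambda>(p, t, u). vector [p, t, u] :: real^3) \<in> borel_measurable borel"
    by (rule borel_measurable_continuous_onI[OF continuous_on_triple_vector])
  fix l u :: "real^3" assume le: "\<And>b. b \<in> Basis \<Longrightarrow> l \<bullet> b \<le> u \<bullet> b"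
  have le': "l $ i \<le> u $ i" for i
    using le[of "axis i 1"] by (simp add: inner_axis)
  have "(\<lambda>(p, t, u). vector [p, t, u]) -` box l u \<inter> space lborel
      = box (l $ 1) (u $ 1) \<times> box (l $ 2) (u $ 2) \<times> box (l $ 3) (u $ 3)"
    by (auto simp: mem_box_cart forall_3)
  then have "emeasure (distr lborel borel (\<lambda>(p, t, u). vector [p, t, u])) (box l u)
      = emeasure lborel (box (l $ 1) (u $ 1) \<times> box (l $ 2) (u $ 2) \<times> box (l $ 3) (u $ 3))"
    by (subst emeasure_distr) auto
  also have "\<dots> = emeasure lborel (box (l $ 1) (u $ 1)) * emeasure lborel (box (l $ 2) (u $ 2) \<times> box (l $ 3) (u $ 3))"
    unfolding lborel_prod[symmetric, where 'b = "real \<times> real"]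
    by (rule lborel.emeasure_pair_measure_Times) (auto intro!: borel_open open_Times)
  also have "emeasure lborel (box (l $ 2) (u $ 2) \<times> box (l $ 3) (u $ 3))
      = emeasure lborel (box (l $ 2) (u $ 2)) * emeasure lborel (box (l $ 3) (u $ 3))"
    unfolding lborel_prod[symmetric, where 'b = real]
    by (rule lborel.emeasure_pair_measure_Times) auto
  also have "emeasure lborel (box (l $ 1) (u $ 1)) * (emeasure lborel (box (l $ 2) (u $ 2)) * emeasure lborel (box (l $ 3) (u $ 3)))
      = ennreal (\<Prod>i\<in>UNIV. u $ i - l $ i)"
  proof -
    have "(\<Prod>i\<in>UNIV. u $ i - l $ i) = (u $ 1 - l $ 1) * ((u $ 2 - l $ 2) * (u $ 3 - l $ 3))"
      unfolding UNIV_3 by simp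
    then show ?thesis using le' by (simp only: ennreal_mult emeasure_lborel_box box_real emeasure_lborel_Ioo diff_ge_0_iff_ge mult_nonneg_nonneg)
  qed
  also have "(\<Prod>i\<in>UNIV. u $ i - l $ i) = (\<Prod>b\<in>Basis. (u - l) \<bullet> b)"
    by (simp add: Basis_vec_def UNION_singleton_eq_range prod.reindex axis_eq_axis inj_on_def inner_axis)
  finally show "emeasure (distr lborel borel (\<lambda>(p, t, u). vector [p, t, u])) (box l u)
      = ennreal (\<Prod>b\<in>Basis. (u - l) \<bullet> b)" .
qed simp

lemma lborel_integral_vector_3:
  fixes H :: "real^3 \<Rightarrow> 'b::{banach, second_countable_topology}"
  assumes "integrable lborel H"
  shows "(\<integral>v. H v \<partial>lborel) = (\<integral>p. \<integral>(t, u). H (vector [p, t, u]) \<partial>lborel \<partial>lborel)"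
proof -
  have T[measurable]: "(\<lambda>(p, t, u). vector [p, t, u] :: real^3) \<in> borel_measurable lborel"
    using borel_measurable_continuous_onI[OF continuous_on_triple_vector] by simp
  have [measurable]: "H \<in> borel_measurable borel"
    using borel_measurable_integrable[OF assms] by simp
  have "integrable lborel (\<lambda>(p, t, u). H (vector [p, t, u]))"
    using assms integrable_distr_eq[OF T, of H]
    by (subst (asm) lborel_vector_3) (simp add: case_prod_unfold)
  then have int: "integrable (lborel \<Otimes>\<^sub>M lborel) (\<lambda>(p, t, u). H (vector [p, t, u]))"
    by (simp add: lborel_prod)
  have "(\<integral>v. H v \<partial>lborel) = (\<integral>(p, t, u). H (vector [p, t, u]) \<partial>lborel)"
    by (subst lborel_vector_3, subst integral_distr[OF T]) (simp_all add: case_prod_unfold)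
  also have "\<dots> = integral\<^sup>L (lborel \<Otimes>\<^sub>M lborel) (\<lambda>(p, t, u). H (vector [p, t, u]))"
    by (simp add: lborel_prod)
  also have "\<dots> = (\<integral>p. \<integral>(t, u). H (vector [p, t, u]) \<partial>lborel \<partial>lborel)"
    using lborel_pair.integral_fst'[OF int] by simp
  finally show ?thesis .
qed

section \<open>Spheroidal coordinates and the surface element\<close>

definition spheroid_map :: "real \<Rightarrow> real \<Rightarrow> real \<Rightarrow> real^3 \<Rightarrow> real^3" where
  "spheroid_map s phi0 y0 v = spheroid_param s (v $ 1) phi0 y0 (v $ 2) (v $ 3)"

text \<open>Open and free of the poles and of the seam \<open>u = 0\<close>, so that
  \<open>spheroid_map\<close> is injective on it; the image still has full measure.\<close>

definition spheroid_domain :: "(real^3) set" where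
  "spheroid_domain = {v. 0 < v $ 1 \<and> 0 < v $ 2 \<and> v $ 2 < pi \<and> 0 < v $ 3 \<and> v $ 3 < 2 * pi}"

definition spheroid_map_deriv :: "real \<Rightarrow> real^3 \<Rightarrow> real^3 \<Rightarrow> real^3" where
  "spheroid_map_deriv s v h = vector
     [h $ 1 * sin (v $ 2) * cos (v $ 3) + h $ 2 * (v $ 1 * cos (v $ 2) * cos (v $ 3)) - h $ 3 * (v $ 1 * sin (v $ 2) * sin (v $ 3)),
      h $ 1 / s * cos (v $ 2) - h $ 2 * (v $ 1 / s * sin (v $ 2)),
      h $ 1 * sin (v $ 2) * sin (v $ 3) + h $ 2 * (v $ 1 * cos (v $ 2) * sin (v $ 3)) + h $ 3 * (v $ 1 * sin (v $ 2) * cos (v $ 3))]"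

lemma has_derivative_vec_nth [derivative_intros]: "((\<lambda>v. v $ i) has_derivative (\<lambda>h. h $ i)) F"
  by (rule bounded_linear_imp_has_derivative[OF bounded_linear_vec_nth])

lemma has_derivative_vector_3:
  fixes a b c :: "'a::real_normed_vector \<Rightarrow> real"
  assumes "(a has_derivative a') (at x within S)" "(b has_derivative b') (at x within S)"
    "(c has_derivative c') (at x within S)"
  shows "((\<lambda>x. vector [a x, b x, c x] :: real^3) has_derivative (\<lambda>h. vector [a' h, b' h, c' h])) (at x within S)"
proof (subst has_derivative_componentwise_within, rule)
  fix e :: "real^3" assume "e \<in> Basis"
  then obtain i where e: "e = axis i 1" by (auto simp: Basis_vec_def)
  show "((\<lambda>x. vector [a x, b x, c x] \<bullet> e) has_derivative (\<lambda>h. vector [a' h, b' h, c' h] \<bullet> e)) (at x within S)"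
    using exhaust_3[of i] assms by (auto simp: e inner_axis)
qed

lemma has_derivative_spheroid_map:
  assumes "0 < s"
  shows "(spheroid_map s phi0 y0 has_derivative spheroid_map_deriv s v) (at v within S)"
  unfolding spheroid_map_def[abs_def] spheroid_param_def spheroid_map_deriv_def[abs_def]
  by (rule has_derivative_vector_3)
    (use assms in \<open>auto intro!: derivative_eq_intros simp: field_simps\<close>)

lemma det_spheroid_map_deriv:
  assumes "0 < s" and v: "v \<in> spheroid_domain"
  shows "\<bar>det (matrix (spheroid_map_deriv s v))\<bar> = (v $ 1)\<^sup>2 * sin (v $ 2) / s"
proof -
  \<comment> \<open>With sines and cosines opaque the determinant is a purely algebraic identity;
    the sums of squares become 1 only afterwards.\<close>
  define a a' b b' where defs: "a = sin (v $ 2)" "a' = cos (v $ 2)" "b = sin (v $ 3)" "b' = cos (v $ 3)"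
  have "det (matrix (spheroid_map_deriv s v)) = (v $ 1)\<^sup>2 / s * (- a) * (a\<^sup>2 + a'\<^sup>2) * (b\<^sup>2 + b'\<^sup>2)"
    unfolding det_3 matrix_def spheroid_map_deriv_def defs[symmetric]
    by (simp add: axis_def field_simps power2_eq_square add_divide_distrib)
  then have "det (matrix (spheroid_map_deriv s v)) = - ((v $ 1)\<^sup>2 * sin (v $ 2) / s)"
    by (simp add: defs)
  moreover have "0 < sin (v $ 2)" using v by (auto simp: spheroid_domain_def intro: sin_gt_zero)
  ultimately show ?thesis using assms(1) by simp
qed

text \<open>Sums of squares recover \<open>p * sin t\<close> from the first and third coordinates,
  and then \<open>p\<close>; injectivity of \<open>cos\<close> on \<open>{0..pi}\<close> gives
  \<open>t\<close>, uniqueness of the argument gives \<open>u\<close>.\<close>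

lemma inj_on_spheroid_map:
  assumes "0 < s" shows "inj_on (spheroid_map s phi0 y0) spheroid_domain"
proof (rule inj_onI)
  fix v w assume v: "v \<in> spheroid_domain" and w: "w \<in> spheroid_domain"
    and eq: "spheroid_map s phi0 y0 v = spheroid_map s phi0 y0 w"
  define p t u p' t' u' where defs: "p = v $ 1" "t = v $ 2" "u = v $ 3" "p' = w $ 1" "t' = w $ 2" "u' = w $ 3"
  have dom: "0 < p" "0 < t" "t < pi" "0 < u" "u < 2 * pi" "0 < p'" "0 < t'" "t' < pi" "0 < u'" "u' < 2 * pi"
    using v w by (auto simp: spheroid_domain_def defs)
  have e1: "p * sin t * cos u = p' * sin t' * cos u'"
    using arg_cong[OF eq, of "\<lambda>x. x $ 1"] by (simp add: spheroid_map_def spheroid_param_def defs)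
  have e2: "p * cos t = p' * cos t'"
    using arg_cong[OF eq, of "\<lambda>x. x $ 2"] assms by (simp add: spheroid_map_def spheroid_param_def defs)
  have e3: "p * sin t * sin u = p' * sin t' * sin u'"
    using arg_cong[OF eq, of "\<lambda>x. x $ 3"] by (simp add: spheroid_map_def spheroid_param_def defs)
  have sint: "0 < sin t" "0 < sin t'" using dom by (auto intro: sin_gt_zero)
  have r: "(r * cos b)\<^sup>2 + (r * sin b)\<^sup>2 = r\<^sup>2" for r b :: real
    unfolding power_mult_distrib by (metis distrib_left mult.right_neutral sin_cos_squared_add2)
  have "(p * sin t)\<^sup>2 = (p' * sin t')\<^sup>2"
    using r[of "p * sin t" u] r[of "p' * sin t'" u'] e1 e3 by simp
  then have e4: "p * sin t = p' * sin t'"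
    by (rule power2_eq_imp_eq) (use dom sint in auto)
  have "p\<^sup>2 = p'\<^sup>2" using r[of p t] r[of p' t'] e2 e4 by simp
  then have p: "p = p'" by (rule power2_eq_imp_eq) (use dom in auto)
  have "cos t = cos t'" using e2 p dom by simp
  then have t: "t = t'" using dom cos_inj_pi[of t t'] by simp
  have "cos u = cos u'" "sin u = sin u'" using e1 e3 p t sint dom by auto
  then have "cis u = cis u'" by (simp add: complex_eq_iff)
  then have u: "u = u'"
    using dom Arg2pi_unique[of 1 u "cis u"] Arg2pi_unique[of 1 u' "cis u'"] by (simp add: cis_conv_exp)
  show "v = w" using p t u by (simp add: vec_eq_iff forall_3 defs)
qed

text \<open>Off the plane \<open>x $ 3 = sin phi0\<close> the coordinates can be solved for:
  \<open>c \<noteq> 0\<close> yields \<open>r > 0\<close>, which keeps \<open>t\<close> away from 0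
  and \<open>pi\<close>, and \<open>sin u \<noteq> 0\<close>, which excludes
  \<open>u = 0\<close>.\<close>

lemma negligible_compl_spheroid_map:
  assumes "0 < s" shows "negligible (- spheroid_map s phi0 y0 ` spheroid_domain)"
proof (rule negligible_subset)
  show "negligible {x :: real^3. x \<bullet> axis 3 1 = sin phi0}"
    by (rule negligible_standard_hyperplane) simp
  show "- spheroid_map s phi0 y0 ` spheroid_domain \<subseteq> {x. x \<bullet> axis 3 1 = sin phi0}"
  proof (rule subsetI, rule ccontr)
    fix x :: "real^3" assume x: "x \<in> - spheroid_map s phi0 y0 ` spheroid_domain" and ne: "x \<notin> {x. x \<bullet> axis 3 1 = sin phi0}"
    define a b c where "a = x $ 1 - cos phi0" and "b = s * (x $ 2 - y0)" and "c = x $ 3 - sin phi0"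
    have c: "c \<noteq> 0" using ne by (simp add: c_def inner_axis)
    define r where "r = sqrt (a\<^sup>2 + c\<^sup>2)"
    define p where "p = sqrt (b\<^sup>2 + r\<^sup>2)"
    have r: "0 < r" "r\<^sup>2 = a\<^sup>2 + c\<^sup>2" using c by (auto simp: r_def sum_power2_gt_zero_iff)
    have p: "0 < p" "p\<^sup>2 = b\<^sup>2 + r\<^sup>2" using r(1) by (auto simp: p_def sum_power2_gt_zero_iff)
    have "(a / r)\<^sup>2 + (c / r)\<^sup>2 = 1" 
      using r(1) unfolding power_divide add_divide_distrib[symmetric] r(2)[symmetric] by simp
    then obtain u where u: "0 \<le> u" "u < 2 * pi" "a / r = cos u" "c / r = sin u" by (rule sincos_total_2pi)
    have "(b / p)\<^sup>2 + (r / p)\<^sup>2 = 1" 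
      using p(1) unfolding power_divide add_divide_distrib[symmetric] p(2)[symmetric] by simp
    then obtain t where t: "0 \<le> t" "t \<le> pi" "b / p = cos t" "r / p = sin t"
      using sincos_total_pi[of "r / p" "b / p"] r(1) p(1) by auto
    have "u \<noteq> 0" using u(4) c r(1) by auto
    moreover have "t \<noteq> 0" "t \<noteq> pi" using t(4) r(1) p(1) by auto
    ultimately have dom: "vector [p, t, u] \<in> spheroid_domain"
      using u t p by (auto simp: spheroid_domain_def)
    have "r = p * sin t" "b = p * cos t" "a = r * cos u" "c = r * sin u"
      using r(1) p(1) by (simp_all add: t(3,4)[symmetric] u(3,4)[symmetric])
    then have "x $ 1 = cos phi0 + p * sin t * cos u" "x $ 2 = y0 + p / s * cos t" "x $ 3 = sin phi0 + p * sin t * sin u"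
      using assms by (auto simp: a_def b_def c_def field_simps)
    then have "x = spheroid_map s phi0 y0 (vector [p, t, u])"
      by (simp add: vec_eq_iff forall_3 spheroid_map_def spheroid_param_def)
    then show False using x dom by blast
  qed
qed

text \<open>The factor \<open>p ^ 2 * sin t / s\<close> is the volume Jacobian; by
  \<open>stretched_norm_spheroid_param\<close> the other factor is the gradient length on the
  spheroid. This coarea relation ties \<open>R_s\<close> to volume integrals.\<close>

lemma norm_cross3_spheroid:
  assumes s: "0 < s" and p: "0 \<le> p" and t: "0 \<le> sin t"
  shows "norm (cross3 (spheroid_dt s p t u) (spheroid_du s p t u))
      = p\<^sup>2 * sin t / s * stretched_norm s (sin t) (cos t)"
proof (rule power2_eq_imp_eq)
  define a a' b b' where defs: "a = sin t" "a' = cos t" "b = sin u" "b' = cos u"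
  have "(norm (cross3 (spheroid_dt s p t u) (spheroid_du s p t u)))\<^sup>2
     = (p\<^sup>2 * a)\<^sup>2 * ((a / s)\<^sup>2 * (b\<^sup>2 + b'\<^sup>2) + (a' * (b\<^sup>2 + b'\<^sup>2))\<^sup>2)"
    unfolding power2_norm_eq_inner inner_vec_def sum_3 cross3_def spheroid_dt_def spheroid_du_def defs[symmetric]
    by (simp add: power2_eq_square field_simps add_divide_distrib)
  also have "\<dots> = (p\<^sup>2 * sin t / s)\<^sup>2 * ((sin t)\<^sup>2 + (s * cos t)\<^sup>2)"
    using s by (simp add: defs power_divide power_mult_distrib field_simps)
  finally show "(norm (cross3 (spheroid_dt s p t u) (spheroid_du s p t u)))\<^sup>2
     = (p\<^sup>2 * sin t / s * stretched_norm s (sin t) (cos t))\<^sup>2"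
    by (simp only: stretched_norm_def power_mult_distrib[of "p\<^sup>2 * sin t / s"]
        real_sqrt_pow2[OF sum_power2_ge_zero])
qed (use s t in auto)

lemma cmod_zeta_spheroid_param:
  assumes "0 \<le> p" "0 \<le> sin t"
  shows "cmod (zeta (spheroid_param s p phi0 y0 t u) - cis phi0) = p * sin t"
proof -
  have "zeta (spheroid_param s p phi0 y0 t u) - cis phi0 = of_real (p * sin t) * cis u"
    by (simp add: zeta_def spheroid_param_def complex_eq_iff)
  then show ?thesis using assms by (simp add: norm_mult)
qed

lemma stretched_norm_spheroid_param:
  assumes s: "0 < s" and p: "0 \<le> p"
  shows "stretched_norm s (p * sin t) (p / s * cos t) = p"
    "stretched_norm (s\<^sup>2) (p * sin t) (p / s * cos t) = p * stretched_norm s (sin t) (cos t)"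
proof -
  have "(p * sin t)\<^sup>2 + (s * (p / s * cos t))\<^sup>2 = p\<^sup>2 * ((sin t)\<^sup>2 + (cos t)\<^sup>2)"
    using s by (simp add: power_mult_distrib flip: distrib_left)
  then show "stretched_norm s (p * sin t) (p / s * cos t) = p" using p by (simp add: stretched_norm_def)
  have "(p * sin t)\<^sup>2 + (s\<^sup>2 * (p / s * cos t))\<^sup>2 = p\<^sup>2 * ((sin t)\<^sup>2 + (s * cos t)\<^sup>2)"
    using s by (simp add: power2_eq_square field_simps)
  then show "stretched_norm (s\<^sup>2) (p * sin t) (p / s * cos t) = p * stretched_norm s (sin t) (cos t)"
    using p by (simp add: stretched_norm_def real_sqrt_mult)
qed

text \<open>The two rectangles differ by a null frontier; the open one matches
  \<open>spheroid_domain\<close>.\<close>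

lemma R_s_eq_open_box:
  assumes [measurable]: "f \<in> borel_measurable borel"
  shows "R_s s f p phi0 y0 = (\<integral>(t, u). indicator ({0<..<pi} \<times> {0<..<2 * pi}) (t, u) *\<^sub>R
     (norm (cross3 (spheroid_dt s p t u) (spheroid_du s p t u)) *\<^sub>R f (spheroid_param s p phi0 y0 t u)) \<partial>lborel)"
proof -
  have box: "{0..pi} \<times> {0..2 * pi} = cbox (0, 0) (pi, 2 * pi)" "{0<..<pi} \<times> {0<..<2 * pi} = box (0, 0) (pi, 2 * pi)"
    by (auto simp: cbox_Pair_eq box_prod)
  have "cbox (0, 0) (pi, 2 * pi) - box (0, 0) (pi, 2 * pi) \<in> null_sets lborel"
    using negligible_frontier_interval[of "(0, 0)" "(pi, 2 * pi)"]
    by (simp add: negligible_iff_null_sets null_sets_completion_iff)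
  then have ae: "AE q in lborel. q \<notin> cbox (0, 0) (pi, 2 * pi) - box (0, 0) (pi, 2 * pi)"
    by (rule AE_not_in)
  have indicator_eq: "indicat_real B q = indicat_real A q" if "A \<subseteq> B" "q \<notin> B - A" for A B and q :: "real \<times> real"
    using that by (auto simp: indicator_def)
  show ?thesis
    unfolding R_s_def set_lebesgue_integral_def box
  proof (rule integral_cong_AE)
    have "continuous_on UNIV (\<lambda>q. cross3 (spheroid_dt s p (fst q) (snd q)) (spheroid_du s p (fst q) (snd q)))"
      unfolding spheroid_dt_def spheroid_du_def
      by (intro continuous_on_cross continuous_on_vector_3 continuous_intros)
    then have [measurable]: "(\<lambda>q. cross3 (spheroid_dt s p (fst q) (snd q)) (spheroid_du s p (fst q) (snd q))) \<in> borel_measurable borel"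
      by (rule borel_measurable_continuous_onI)
    have "continuous_on UNIV (\<lambda>q. spheroid_param s p phi0 y0 (fst q) (snd q))"
      unfolding spheroid_param_def by (intro continuous_on_vector_3 continuous_intros)
    then have [measurable]: "(\<lambda>q. spheroid_param s p phi0 y0 (fst q) (snd q)) \<in> borel_measurable borel"
      by (rule borel_measurable_continuous_onI)
    have [measurable]: "(\<lambda>(t, u). norm (cross3 (spheroid_dt s p t u) (spheroid_du s p t u)) *\<^sub>R f (spheroid_param s p phi0 y0 t u)) \<in> borel_measurable borel"
      unfolding case_prod_unfold by measurable
    show "(\<lambda>q. indicat_real (cbox (0, 0) (pi, 2 * pi)) q *\<^sub>R
        (case q of (t, u) \<Rightarrow> norm (cross3 (spheroid_dt s p t u) (spheroid_du s p t u)) *\<^sub>R f (spheroid_param s p phi0 y0 t u))) \<in> borel_measurable lborel"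
      by measurable
    have "(\<lambda>q. indicat_real (box (0, 0) (pi, 2 * pi)) q *\<^sub>R
        (case q of (t, u) \<Rightarrow> norm (cross3 (spheroid_dt s p t u) (spheroid_du s p t u)) *\<^sub>R f (spheroid_param s p phi0 y0 t u))) \<in> borel_measurable lborel"
      by measurable
    then show "(\<lambda>(t, u). indicat_real (box (0, 0) (pi, 2 * pi)) (t, u) *\<^sub>R
        norm (cross3 (spheroid_dt s p t u) (spheroid_du s p t u)) *\<^sub>R f (spheroid_param s p phi0 y0 t u)) \<in> borel_measurable lborel"
      by (simp add: case_prod_unfold)
    show "AE q in lborel. indicat_real (cbox (0, 0) (pi, 2 * pi)) q *\<^sub>R
        (case q of (t, u) \<Rightarrow> norm (cross3 (spheroid_dt s p t u) (spheroid_du s p t u)) *\<^sub>R f (spheroid_param s p phi0 y0 t u))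
      = (case q of (t, u) \<Rightarrow> indicat_real (box (0, 0) (pi, 2 * pi)) (t, u) *\<^sub>R
        norm (cross3 (spheroid_dt s p t u) (spheroid_du s p t u)) *\<^sub>R f (spheroid_param s p phi0 y0 t u))"
      using ae
    proof (rule eventually_mono)
      fix q :: "real \<times> real" assume "q \<notin> cbox (0, 0) (pi, 2 * pi) - box (0, 0) (pi, 2 * pi)"
      then have "indicat_real (cbox (0, 0) (pi, 2 * pi)) q = indicat_real (box (0, 0) (pi, 2 * pi)) q"
        by (rule indicator_eq[OF box_subset_cbox])
      then show "indicat_real (cbox (0, 0) (pi, 2 * pi)) q *\<^sub>R
        (case q of (t, u) \<Rightarrow> norm (cross3 (spheroid_dt s p t u) (spheroid_du s p t u)) *\<^sub>R f (spheroid_param s p phi0 y0 t u))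
      = (case q of (t, u) \<Rightarrow> indicat_real (box (0, 0) (pi, 2 * pi)) (t, u) *\<^sub>R
        norm (cross3 (spheroid_dt s p t u) (spheroid_du s p t u)) *\<^sub>R f (spheroid_param s p phi0 y0 t u))"
        by (simp only: case_prod_unfold prod.collapse)
    qed
  qed
qed

context cylinder_supported
begin

text \<open>In coordinates \<open>(p, t, u)\<close> the denominator is \<open>p ^ m\<close>, and the
  numerator times the Jacobian is \<open>p\<close> times the surface element. So the slice at
  \<open>p > 0\<close> of the volume integral is \<open>p / p ^ m\<close> times \<open>R_s\<close>,
  hence 0, and slices with \<open>p \<le> 0\<close> lie outside the domain.\<close>

lemma integral_spheroid_kernel_eq_0:
  assumes s: "0 < s"
    and R: "\<And>p. 0 < p \<Longrightarrow> R_s s f p phi0 y0 = 0"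
  shows "(\<integral>x. f x * of_real (stretched_norm (s\<^sup>2) (cmod (zeta x - cis phi0)) (x $ 2 - y0)
       / stretched_norm s (cmod (zeta x - cis phi0)) (x $ 2 - y0) ^ m) \<partial>lborel) = 0"
proof -
  let ?W = "\<lambda>x. stretched_norm (s\<^sup>2) (cmod (zeta x - cis phi0)) (x $ 2 - y0)"
  let ?G = "\<lambda>x. stretched_norm s (cmod (zeta x - cis phi0)) (x $ 2 - y0)"
  define F where "F x = f x * of_real (?W x / ?G x ^ m)" for x
  have "0 < cmod (zeta x - cis phi0)" if "x \<in> K" for x
    using obtain_distance_bound that by (metis less_le_trans)
  then have G: "?G x \<noteq> 0" if "x \<in> K" for x
    using that stretched_norm_pos by (metis less_irrefl)
  have F: "integrable lborel F"
    unfolding F_def by (intro integrable_mult_continuous continuous_intros) (use G in auto)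
  define J where "J v = (v $ 1)\<^sup>2 * sin (v $ 2) / s" for v :: "real^3"
  let ?g = "spheroid_map s phi0 y0"
  have "open spheroid_domain"
    unfolding spheroid_domain_def by (intro open_Collect_conj open_Collect_less continuous_intros)
  then have S: "spheroid_domain \<in> sets borel" by simp
  have g: "?g \<in> borel_measurable borel"
    by (rule borel_measurable_continuous_onI[OF has_derivative_continuous_on[OF has_derivative_spheroid_map[OF s]]])
  have J: "J \<in> borel_measurable borel"
    unfolding J_def using s by (intro borel_measurable_continuous_onI continuous_intros) auto
  have f_borel: "f \<in> borel_measurable borel"
    using borel_measurable_integrable[OF integrable_f] by simp
  note cov = integral_change_of_variables_lborel[OF F S inj_on_spheroid_map[OF s]
      negligible_compl_spheroid_map[OF s] has_derivative_spheroid_map[OF s] det_spheroid_map_deriv[OF s, folded J_def] g J]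
  have slice: "(\<integral>(t, u). indicator spheroid_domain (vector [p, t, u]) *\<^sub>R J (vector [p, t, u]) *\<^sub>R F (?g (vector [p, t, u])) \<partial>lborel) = 0"
    for p
  proof (cases "0 < p")
    case True
    have eq: "indicator spheroid_domain (vector [p, t, u]) *\<^sub>R J (vector [p, t, u]) *\<^sub>R F (?g (vector [p, t, u]))
        = of_real (p / p ^ m) * (indicator ({0<..<pi} \<times> {0<..<2 * pi}) (t, u) *\<^sub>R
     (norm (cross3 (spheroid_dt s p t u) (spheroid_du s p t u)) *\<^sub>R f (spheroid_param s p phi0 y0 t u)))" for t u
    proof (cases "vector [p, t, u] \<in> spheroid_domain")
      case True
      then have tu: "(t, u) \<in> {0<..<pi} \<times> {0<..<2 * pi}" by (auto simp: spheroid_domain_def)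
      then have t: "0 \<le> sin t" by (auto intro: sin_ge_zero)
      have p: "0 \<le> p" using \<open>0 < p\<close> by simp
      have z: "spheroid_param s p phi0 y0 t u $ 2 - y0 = p / s * cos t"
        by (simp add: spheroid_param_def)
      have "F (?g (vector [p, t, u])) = f (spheroid_param s p phi0 y0 t u)
          * of_real (p * stretched_norm s (sin t) (cos t) / p ^ m)"
        unfolding F_def spheroid_map_def vector_3 cmod_zeta_spheroid_param[OF p t] z stretched_norm_spheroid_param[OF s p] ..
      then show ?thesis
        using True tu by (simp add: J_def norm_cross3_spheroid[OF s p t] scaleR_conv_of_real mult_ac)
    next
      case False
      then have "(t, u) \<notin> {0<..<pi} \<times> {0<..<2 * pi}" using \<open>0 < p\<close> by (auto simp: spheroid_domain_def)
      with False show ?thesis by simp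
    qed
    have "(\<integral>(t, u). indicator spheroid_domain (vector [p, t, u]) *\<^sub>R J (vector [p, t, u]) *\<^sub>R F (?g (vector [p, t, u])) \<partial>lborel)
       = of_real (p / p ^ m) * R_s s f p phi0 y0"
      by (simp only: eq R_s_eq_open_box[OF f_borel] case_prod_unfold integral_mult_right_zero)
    then show ?thesis using R[OF True] by simp
  next
    case False
    then have "indicator spheroid_domain (vector [p, t, u]) = (0 :: real)" for t u
      by (simp add: spheroid_domain_def)
    then show ?thesis by (simp add: case_prod_unfold)
  qed
  have "(\<integral>x. F x \<partial>lborel) = (\<integral>v. indicator spheroid_domain v *\<^sub>R J v *\<^sub>R F (?g v) \<partial>lborel)"
    using cov(2) by simp
  also have "\<dots> = (\<integral>p. \<integral>(t, u). indicator spheroid_domain (vector [p, t, u]) *\<^sub>R J (vector [p, t, u]) *\<^sub>R F (?g (vector [p, t, u])) \<partial>lborel \<partial>lborel)"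
    by (rule lborel_integral_vector_3[OF cov(1)])
  also have "\<dots> = 0" by (simp only: slice Bochner_Integration.integral_zero)
  finally show ?thesis by (simp only: F_def)
qed

end

text \<open>Integrability follows from \<open>cmod (f x) \<le> 1 + (cmod (f x)) ^ 2\<close> on
  \<open>K\<close>, a set of finite measure.\<close>

lemma L2c_imp_cylinder_supported:
  assumes "f \<in> L2c unit_cyl"
  shows "\<exists>K. cylinder_supported f K"
proof -
  obtain K where K: "compact K" "K \<subseteq> unit_cyl" "\<And>x. x \<notin> K \<Longrightarrow> f x = 0"
    and f: "f \<in> borel_measurable lborel" "integrable lborel (\<lambda>x. (cmod (f x))\<^sup>2)"
    using assms by (auto simp: L2c_def)
  have "integrable lborel (\<lambda>x. indicat_real K x + (cmod (f x))\<^sup>2)"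
    using f(2) K(1) emeasure_bounded_finite[OF compact_imp_bounded[OF K(1)]]
    by (intro Bochner_Integration.integrable_add integrable_real_indicator) (auto simp: borel_compact)
  then have "integrable lborel f"
  proof (rule Bochner_Integration.integrable_bound)
    show "AE x in lborel. norm (f x) \<le> norm (indicat_real K x + (cmod (f x))\<^sup>2)"
    proof (rule AE_I2)
      fix x
      have "2 * cmod (f x) \<le> 1 + (cmod (f x))\<^sup>2"
        using sum_squares_bound[of 1 "cmod (f x)"] by simp
      moreover have "0 \<le> 1 + (cmod (f x))\<^sup>2" by simp
      ultimately have "cmod (f x) \<le> 1 + (cmod (f x))\<^sup>2" by linarith
      then show "norm (f x) \<le> norm (indicat_real K x + (cmod (f x))\<^sup>2)"
        using K(3)[of x] by (cases "x \<in> K") auto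
    qed
  qed (use f in simp)
  then show ?thesis using K by (intro exI[of _ K]) (unfold_locales; auto)
qed

theorem theorem4p2:
  fixes s :: real and f :: "real^3 \<Rightarrow> complex"
  assumes "0 < s" and "s \<le> 1"
    and "f \<in> L2c unit_cyl"
    and "\<And>p phi0 y0. 0 < p \<Longrightarrow> 0 \<le> phi0 \<Longrightarrow> phi0 \<le> 2 * pi \<Longrightarrow> R_s s f p phi0 y0 = 0"
  shows "AE x in lborel. f x = 0"
proof -
  obtain K where "cylinder_supported f K"
    using L2c_imp_cylinder_supported[OF assms(3)] by blast
  then interpret cylinder_supported f K .
  show ?thesis
  proof (rule AE_eq_0_if_distance_powers)
    fix j k t
    \<comment> \<open>The distance powers involve every angle \<open>t\<close>, the hypothesis on
      \<open>R_s\<close> only those in \<open>{0..2 * pi}\<close>.\<close>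
    obtain phi0 where phi0: "0 \<le> phi0" "phi0 < 2 * pi" "cos t = cos phi0" "sin t = sin phi0"
      by (rule sincos_total_2pi[of "cos t" "sin t"]) simp_all
    then have t: "cis t = cis phi0" by (simp add: complex_eq_iff)
    have R: "R_s s f p phi0 y0 = 0" if "0 < p" for p y0
      using assms(4)[OF that] phi0(1,2) by simp
    have "continuous_on {0<..} (\<lambda>r::real. r ^ (2 * k))" by (intro continuous_intros)
    from integral_distance_function_eq_0[OF assms(1,2) integral_spheroid_kernel_eq_0[OF assms(1) R] this, of j]
    show "(\<integral>x. f x * (of_real (x $ 2) ^ j * of_real (cmod (zeta x - cis t) ^ (2 * k))) \<partial>lborel) = 0"
      by (simp add: t)
  qed
qed

end
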